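(* Let $\Bbbk$ be a field, $A$ a unital associative $\Bbbk$-algebra, and $(P_\bullet,\partial_\bullet)$ a projective resolution of $A$ by $A$-bimodules with augmentation $\mu:P_0\to A$. Let $i_0:P_0\to B_0(A)$ be the $0$-th component of a morphism $i_\bullet:P_\bullet\to B_\bullet(A)$ of complexes of $A$-bimodules lifting $\mathrm{id}_A$, where $B_\bullet(A)$ is the bar resolution. Let $\rho$ be an element of the center $\mathcal{Z}(A)$ of $A$ and let $\ell_\rho\in\operatorname{Hom}_{A^e}(B_0(A),A)$ be the morphism with $\ell_\rho(1|1)=\rho$. For $n\in\mathbb{N}_0$ let $\eta_n:P_n\to P_n$ be given by $\eta_n(v)=\rho v-v\rho$. Then $\eta_\bullet=\{\eta_n\}_{n\in\mathbb{N}_0}$ is a lifting of the zero morphism from $A$ to itself, hence null-homotopic: there is a family $h^\rho_\bullet=\{h^\rho_n:P_n\to P_{n+1}\}_{n\in\mathbb{N}_0}$ of morphisms of $A$-bimodules such that $$\eta_0=\partial_1h^\rho_0\quad\text{and}\quad \eta_n=h^\rho_{n-1}\partial_n+\partial_{n+1}h^\rho_n\ \text{ for } n\in\mathbb{N}.$$ Moreover, for such a family $h^\rho_\bullet$ and any cocycle $\phi\in\operatorname{Hom}_{A^e}(P_n,A)$ with $n\in\mathbb{N}_0$, the Gerstenhaber bracket $[\phi,\ell_\rho i_0]\in\operatorname{HH}^{n-1}(A)$ is the cohomology class of $\phi h^\rho_{n-1}$.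
   Context: $A^e$ is the enveloping algebra, $\mathbb{N}$ the positive integers, $\mathbb{N}_0$ the nonnegative integers, and juxtaposition of maps denotes composition. For $n=0$ one has $\operatorname{HH}^{-1}(A)=0$ and $h^\rho_{-1}=0$. Bar resolution: $B_n(A)=A^{\otimes(n+2)}$, $d_n(a_0|\dots|a_{n+1})=\sum_{j=0}^n(-1)^ja_0|\dots|a_{j-1}|a_ja_{j+1}|a_{j+2}|\dots|a_{n+1}$ (vertical bars denote $\otimes$), with augmentation $B_0(A)=A\otimes A\to A$ the multiplication. There are mutually inverse isomorphisms $F:\operatorname{Hom}_{A^e}(B_n(A),A)\to\operatorname{Hom}_\Bbbk(A^{\otimes n},A)$, $F(f)(a_1|\dots|a_n)=f(1|a_1|\dots|a_n|1)$, and $G$, $G(g)(a_0|\dots|a_{n+1})=a_0g(a_1|\dots|a_n)a_{n+1}$. Gerstenhaber bracket: for $f\in\operatorname{Hom}_\Bbbk(A^{\otimes m},A)$, $g\in\operatorname{Hom}_\Bbbk(A^{\otimes n},A)$, set $[f,g]=f\circ_Gg-(-1)^{(m-1)(n-1)}g\circ_Gf$, where $$(f\circ_Gg)(a_1|\dots|a_{m+n-1})=\sum_{i=1}^m(-1)^{(n-1)(i-1)}f(a_1|\dots|a_{i-1}|g(a_i|\dots|a_{i+n-1})|a_{i+n}|\dots|a_{m+n-1}),$$ with $f\circ_Gg=0$ if $m=0$, and with $g(1)$ inserted in place of $g(a_i|\dots|a_{i+n-1})$ if $n=0$. On $\operatorname{Hom}_{A^e}(B_\bullet(A),A)$ put $[f,g]=G([F(f),F(g)])$.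 For a projective bimodule resolution $P_\bullet$, let $i_\bullet:P_\bullet\to B_\bullet(A)$ and $p_\bullet:B_\bullet(A)\to P_\bullet$ be morphisms of complexes of bimodules lifting $\mathrm{id}_A$; for cocycles $f\in\operatorname{Hom}_{A^e}(P_m,A)$, $g\in\operatorname{Hom}_{A^e}(P_n,A)$, the bracket $[f,g]\in H^{m+n-1}(\operatorname{Hom}_{A^e}(P_\bullet,A))\cong\operatorname{HH}^{m+n-1}(A)$ is the class of $[fp_m,gp_n]\,i_{m+n-1}$ (independent of the choices). *)

theory Defs
  imports Complex_Main "HOL-Algebra.Ring" "HOL-Library.Poly_Mapping"
begin

section \<open>Algebras, bimodules and their morphisms\<close>

text \<open>
  The sort \<open>{ring, monoid_mult}\<close> is that of unital associative rings. Unlike \<open>ring_1\<close> it does not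
  demand \<open>0 \<noteq> 1\<close>, so the zero algebra is included.
\<close>

locale assoc_algebra = vector_space s
  for s :: "'k::field \<Rightarrow> 'a::{ring,monoid_mult} \<Rightarrow> 'a" +
  assumes scale_mult_left: "s c x * y = s c (x * y)"
    and scale_mult_right: "x * s c y = s c (x * y)"

text \<open>
  As for modules in \<open>HOL-Algebra\<close>, the ring record only provides the underlying abelian group;
  its fields \<open>mult\<close> and \<open>one\<close> are unused. Carriers are explicit because the bimodules of a
  resolution vary with the degree.
\<close>

record ('a, 'm) bimodule = "'m ring" +
  lact :: "'a \<Rightarrow> 'm \<Rightarrow> 'm"
  ract :: "'m \<Rightarrow> 'a \<Rightarrow> 'm"

text \<open>
  The last axiom says that the ground field acts in the same way from both sides, i.e. that we have
  a module over the enveloping algebra.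
\<close>

locale bimodule = abelian_group M
  for s :: "'k::field \<Rightarrow> 'a::{ring,monoid_mult} \<Rightarrow> 'a"
    and M :: "('a, 'm) bimodule" (structure) +
  assumes lact_closed: "v \<in> carrier M \<Longrightarrow> lact M a v \<in> carrier M"
    and ract_closed: "v \<in> carrier M \<Longrightarrow> ract M v a \<in> carrier M"
    and lact_add: "v \<in> carrier M \<Longrightarrow> w \<in> carrier M \<Longrightarrow> lact M a (v \<oplus> w) = lact M a v \<oplus> lact M a w"
    and ract_add: "v \<in> carrier M \<Longrightarrow> w \<in> carrier M \<Longrightarrow> ract M (v \<oplus> w) a = ract M v a \<oplus> ract M w a"
    and add_lact: "v \<in> carrier M \<Longrightarrow> lact M (a + b) v = lact M a v \<oplus> lact M b v"
    and add_ract: "v \<in> carrier M \<Longrightarrow> ract M v (a + b) = ract M v a \<oplus> ract M v b"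
    and lact_mult: "v \<in> carrier M \<Longrightarrow> lact M (a * b) v = lact M a (lact M b v)"
    and ract_mult: "v \<in> carrier M \<Longrightarrow> ract M v (a * b) = ract M (ract M v a) b"
    and lact_one: "v \<in> carrier M \<Longrightarrow> lact M 1 v = v"
    and ract_one: "v \<in> carrier M \<Longrightarrow> ract M v 1 = v"
    and lact_ract: "v \<in> carrier M \<Longrightarrow> lact M a (ract M v b) = ract M (lact M a v) b"
    and scale_central: "v \<in> carrier M \<Longrightarrow> lact M (s c 1) v = ract M v (s c 1)"

definition regular_bimodule :: "('a::{ring,monoid_mult}, 'a) bimodule" where
  "regular_bimodule =
    \<lparr>carrier = UNIV, mult = (*), one = 1, zero = 0, add = (+), lact = (*), ract = (*)\<rparr>"

text \<open>Morphisms are only constrained on the carrier and have to be compared there.\<close>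

definition bimod_hom :: "('a, 'm) bimodule \<Rightarrow> ('a, 'n) bimodule \<Rightarrow> ('m \<Rightarrow> 'n) set" where
  "bimod_hom M N =
    {f \<in> carrier M \<rightarrow> carrier N.
      (\<forall>v\<in>carrier M. \<forall>w\<in>carrier M. f (v \<oplus>\<^bsub>M\<^esub> w) = f v \<oplus>\<^bsub>N\<^esub> f w) \<and>
      (\<forall>a. \<forall>v\<in>carrier M. f (lact M a v) = lact N a (f v)) \<and>
      (\<forall>a. \<forall>v\<in>carrier M. f (ract M v a) = ract N (f v) a)}"

text \<open>
  Projectivity is the lifting property against surjections of bimodules. The test bimodules have to
  live in one fixed type. The one chosen here loses nothing: after a choice of representatives it
  contains the free bimodule \<open>A \<otimes> \<k>Q \<otimes> A\<close> on the set \<open>Q\<close> underlying the bimodule, and it also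
  contains a copy of \<open>Q\<close> itself. Hence the lifting property for this type makes \<open>Q\<close> a retract of a
  free bimodule, which gives the lifting property against test bimodules in every other type.
\<close>

definition projective_bimodule ::
    "('k::field \<Rightarrow> 'a::{ring,monoid_mult} \<Rightarrow> 'a) \<Rightarrow> ('a, 'm) bimodule \<Rightarrow> bool" where
  "projective_bimodule s Q \<longleftrightarrow> bimodule s Q \<and>
    (\<forall>(M :: ('a, ('a \<times> 'm \<times> 'a) \<Rightarrow>\<^sub>0 'k) bimodule) (N :: ('a, ('a \<times> 'm \<times> 'a) \<Rightarrow>\<^sub>0 'k) bimodule).
      \<forall>g \<in> bimod_hom M N. \<forall>f \<in> bimod_hom Q N.
        bimodule s M \<and> bimodule s N \<and> g ` carrier M = carrier N \<longrightarrow>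
          (\<exists>h \<in> bimod_hom Q M. \<forall>v\<in>carrier Q. g (h v) = f v))"

section \<open>Resolutions and liftings\<close>

text \<open>
  A complex is given by its objects \<open>P n\<close> and its differentials \<open>\<delta> n\<close>, from \<open>P n\<close> to
  \<open>P (n - 1)\<close>, for \<open>n \<ge> 1\<close>; the value \<open>\<delta> 0\<close> is irrelevant.
\<close>

definition projective_resolution ::
    "('k::field \<Rightarrow> 'a::{ring,monoid_mult} \<Rightarrow> 'a) \<Rightarrow> (nat \<Rightarrow> ('a, 'p) bimodule) \<Rightarrow>
      (nat \<Rightarrow> 'p \<Rightarrow> 'p) \<Rightarrow> ('p \<Rightarrow> 'a) \<Rightarrow> bool" where
  "projective_resolution s P \<delta> \<mu> \<longleftrightarrow>
    (\<forall>n. projective_bimodule s (P n)) \<and>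
    (\<forall>n. \<delta> (Suc n) \<in> bimod_hom (P (Suc n)) (P n)) \<and>
    \<mu> \<in> bimod_hom (P 0) regular_bimodule \<and>
    \<mu> ` carrier (P 0) = UNIV \<and>
    \<delta> 1 ` carrier (P 1) = {v \<in> carrier (P 0). \<mu> v = 0} \<and>
    (\<forall>n. \<delta> (Suc (Suc n)) ` carrier (P (Suc (Suc n))) =
         {v \<in> carrier (P (Suc n)). \<delta> (Suc n) v = \<zero>\<^bsub>P n\<^esub>})"

definition is_lifting ::
    "(nat \<Rightarrow> ('a, 'p) bimodule) \<Rightarrow> (nat \<Rightarrow> 'p \<Rightarrow> 'p) \<Rightarrow> ('p \<Rightarrow> 'a) \<Rightarrow>
     (nat \<Rightarrow> ('a, 'q) bimodule) \<Rightarrow> (nat \<Rightarrow> 'q \<Rightarrow> 'q) \<Rightarrow> ('q \<Rightarrow> 'a) \<Rightarrow>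
     ('a \<Rightarrow> 'a) \<Rightarrow> (nat \<Rightarrow> 'p \<Rightarrow> 'q) \<Rightarrow> bool" where
  "is_lifting P \<delta> \<mu> Q d \<nu> \<alpha> f \<longleftrightarrow>
    (\<forall>n. f n \<in> bimod_hom (P n) (Q n)) \<and>
    (\<forall>n. \<forall>v\<in>carrier (P (Suc n)). d (Suc n) (f (Suc n) v) = f n (\<delta> (Suc n) v)) \<and>
    (\<forall>v\<in>carrier (P 0). \<nu> (f 0 v) = \<alpha> (\<mu> v))"

section \<open>Tensor powers of the algebra\<close>

text \<open>
  The \<open>n\<close>-th tensor power is the free vector space on the lists of length \<open>n\<close> modulo the
  subspace \<open>tensor_rel s n\<close> expressing multilinearity; its elements are cosets.
\<close>

type_synonym ('a, 'k) tensor = "('a list \<Rightarrow>\<^sub>0 'k) set"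

definition fscale :: "'k::field \<Rightarrow> ('x \<Rightarrow>\<^sub>0 'k) \<Rightarrow> ('x \<Rightarrow>\<^sub>0 'k)" where
  "fscale c x = Poly_Mapping.map ((*) c) x"

definition tensor_rel ::
    "('k::field \<Rightarrow> 'a::{ring,monoid_mult} \<Rightarrow> 'a) \<Rightarrow> nat \<Rightarrow> ('a list \<Rightarrow>\<^sub>0 'k) set" where
  "tensor_rel s n = module.span fscale
    ({Poly_Mapping.single (us @ [a + b] @ vs) 1
        - Poly_Mapping.single (us @ [a] @ vs) 1
        - Poly_Mapping.single (us @ [b] @ vs) 1
      | us a b vs. length us + 1 + length vs = n} \<union>
     {Poly_Mapping.single (us @ [s c a] @ vs) 1
        - Poly_Mapping.single (us @ [a] @ vs) c
      | us c a vs. length us + 1 + length vs = n})"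

definition tcoset ::
    "('k::field \<Rightarrow> 'a::{ring,monoid_mult} \<Rightarrow> 'a) \<Rightarrow> nat \<Rightarrow> ('a list \<Rightarrow>\<^sub>0 'k) \<Rightarrow> ('a, 'k) tensor"
  where "tcoset s n x = {x + r | r. r \<in> tensor_rel s n}"

definition tensor_power ::
    "('k::field \<Rightarrow> 'a::{ring,monoid_mult} \<Rightarrow> 'a) \<Rightarrow> nat \<Rightarrow> ('a, 'k) tensor set" where
  "tensor_power s n = tcoset s n ` {x. \<forall>l \<in> Poly_Mapping.keys x. length l = n}"

text \<open>The pure tensor \<open>a\<^sub>1 | \<dots> | a\<^sub>n\<close>; for the empty list this is the unit of the field.\<close>

definition pure_tensor ::
    "('k::field \<Rightarrow> 'a::{ring,monoid_mult} \<Rightarrow> 'a) \<Rightarrow> 'a list \<Rightarrow> ('a, 'k) tensor" where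
  "pure_tensor s l = tcoset s (length l) (Poly_Mapping.single l 1)"

text \<open>
  Maps out of a tensor power are given by their values on pure tensors: \<open>tensor_map\<close> is for maps
  into the \<open>m\<close>-th tensor power (where the values are given as representatives) and
  \<open>tensor_lift\<close> for maps into the algebra. Both are meaningful for multilinear \<open>\<psi>\<close>, when the
  result does not depend on the representative \<open>x\<close> of \<open>X\<close>.
\<close>

definition tensor_map ::
    "('k::field \<Rightarrow> 'a::{ring,monoid_mult} \<Rightarrow> 'a) \<Rightarrow> nat \<Rightarrow> ('a list \<Rightarrow> ('a list \<Rightarrow>\<^sub>0 'k)) \<Rightarrow>
      ('a, 'k) tensor \<Rightarrow> ('a, 'k) tensor" where
  "tensor_map s m \<psi> X =
    (\<Union>x\<in>X. tcoset s m (\<Sum>l\<in>Poly_Mapping.keys x. fscale (Poly_Mapping.lookup x l) (\<psi> l)))"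

definition tensor_lift ::
    "('k::field \<Rightarrow> 'a::{ring,monoid_mult} \<Rightarrow> 'a) \<Rightarrow> ('a list \<Rightarrow> 'a) \<Rightarrow> ('a, 'k) tensor \<Rightarrow> 'a" where
  "tensor_lift s \<psi> X =
    (THE y. \<forall>x\<in>X. y = (\<Sum>l\<in>Poly_Mapping.keys x. s (Poly_Mapping.lookup x l) (\<psi> l)))"

section \<open>The bar resolution\<close>

definition bar ::
    "('k::field \<Rightarrow> 'a::{ring,monoid_mult} \<Rightarrow> 'a) \<Rightarrow> nat \<Rightarrow> ('a, ('a, 'k) tensor) bimodule" where
  "bar s n =
    \<lparr>carrier = tensor_power s (n + 2),
     mult = undefined,
     one = undefined,
     zero = tcoset s (n + 2) 0,
     add = (\<lambda>X Y. {x + y | x y. x \<in> X \<and> y \<in> Y}),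
     lact = (\<lambda>a. tensor_map s (n + 2) (\<lambda>l. Poly_Mapping.single ((a * hd l) # tl l) 1)),
     ract = (\<lambda>X a. tensor_map s (n + 2)
               (\<lambda>l. Poly_Mapping.single (butlast l @ [last l * a]) 1) X)\<rparr>"

definition bar_diff ::
    "('k::field \<Rightarrow> 'a::{ring,monoid_mult} \<Rightarrow> 'a) \<Rightarrow> nat \<Rightarrow> ('a, 'k) tensor \<Rightarrow> ('a, 'k) tensor" where
  "bar_diff s n = tensor_map s (n + 1)
    (\<lambda>l. \<Sum>j=0..n. Poly_Mapping.single (take j l @ [l ! j * l ! (j + 1)] @ drop (j + 2) l) ((-1) ^ j))"

definition bar_aug ::
    "('k::field \<Rightarrow> 'a::{ring,monoid_mult} \<Rightarrow> 'a) \<Rightarrow> ('a, 'k) tensor \<Rightarrow> 'a" where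
  "bar_aug s = tensor_lift s (\<lambda>l. l ! 0 * l ! 1)"

text \<open>The mutually inverse isomorphisms \<open>F\<close> and \<open>G\<close> between
  \<open>Hom\<^sub>A\<^sub>e(B\<^sub>n(A), A)\<close> and \<open>Hom\<^sub>\<k>(A\<^bsup>\<otimes>n\<^esup>, A)\<close>.\<close>

definition bar_F ::
    "('k::field \<Rightarrow> 'a::{ring,monoid_mult} \<Rightarrow> 'a) \<Rightarrow>
      (('a, 'k) tensor \<Rightarrow> 'a) \<Rightarrow> ('a, 'k) tensor \<Rightarrow> 'a" where
  "bar_F s f = tensor_lift s (\<lambda>l. f (pure_tensor s ([1] @ l @ [1])))"

definition bar_G ::
    "('k::field \<Rightarrow> 'a::{ring,monoid_mult} \<Rightarrow> 'a) \<Rightarrow>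
      (('a, 'k) tensor \<Rightarrow> 'a) \<Rightarrow> ('a, 'k) tensor \<Rightarrow> 'a" where
  "bar_G s g = tensor_lift s (\<lambda>l. hd l * g (pure_tensor s (butlast (tl l))) * last l)"

section \<open>The Gerstenhaber bracket\<close>

text \<open>
  The exponents of the signs are integers, since \<open>n - 1\<close> may be negative. For \<open>m = 0\<close> the sum is
  empty; for \<open>n = 0\<close> the inserted element is \<open>g\<close> at the unit of the field.
\<close>

definition gerst_circ ::
    "('k::field \<Rightarrow> 'a::{ring,monoid_mult} \<Rightarrow> 'a) \<Rightarrow> nat \<Rightarrow> (('a, 'k) tensor \<Rightarrow> 'a) \<Rightarrow>
      nat \<Rightarrow> (('a, 'k) tensor \<Rightarrow> 'a) \<Rightarrow> ('a, 'k) tensor \<Rightarrow> 'a" where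
  "gerst_circ s m f n g = tensor_lift s
    (\<lambda>l. \<Sum>i=1..m. s ((-1) powi ((int n - 1) * (int i - 1)))
       (f (pure_tensor s
            (take (i - 1) l @ [g (pure_tensor s (take n (drop (i - 1) l)))] @ drop (i - 1 + n) l))))"

definition gerst_bracket ::
    "('k::field \<Rightarrow> 'a::{ring,monoid_mult} \<Rightarrow> 'a) \<Rightarrow> nat \<Rightarrow> (('a, 'k) tensor \<Rightarrow> 'a) \<Rightarrow>
      nat \<Rightarrow> (('a, 'k) tensor \<Rightarrow> 'a) \<Rightarrow> ('a, 'k) tensor \<Rightarrow> 'a" where
  "gerst_bracket s m f n g X =
    gerst_circ s m f n g X - s ((-1) powi ((int m - 1) * (int n - 1))) (gerst_circ s n g m f X)"

definition bar_bracket ::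
    "('k::field \<Rightarrow> 'a::{ring,monoid_mult} \<Rightarrow> 'a) \<Rightarrow> nat \<Rightarrow> (('a, 'k) tensor \<Rightarrow> 'a) \<Rightarrow>
      nat \<Rightarrow> (('a, 'k) tensor \<Rightarrow> 'a) \<Rightarrow> ('a, 'k) tensor \<Rightarrow> 'a" where
  "bar_bracket s m f n g = bar_G s (gerst_bracket s m (bar_F s f) n (bar_F s g))"

section \<open>Hochschild cohomology from a resolution\<close>

text \<open>
  Degrees are integers here, because the bracket of two elements of degree \<open>0\<close> has degree \<open>-1\<close>.
  A complex is continued to negative degrees by zero bimodules.
\<close>

definition cx_obj :: "(nat \<Rightarrow> ('a, 'p) bimodule) \<Rightarrow> int \<Rightarrow> ('a, 'p) bimodule" where
  "cx_obj P d = (if d < 0 then (P 0)\<lparr>carrier := {\<zero>\<^bsub>P 0\<^esub>}\<rparr> else P (nat d))"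

definition cx_diff ::
    "(nat \<Rightarrow> ('a, 'p) bimodule) \<Rightarrow> (nat \<Rightarrow> 'p \<Rightarrow> 'p) \<Rightarrow> int \<Rightarrow> 'p \<Rightarrow> 'p" where
  "cx_diff P \<delta> d = (if d \<le> 0 then (\<lambda>v. \<zero>\<^bsub>P 0\<^esub>) else \<delta> (nat d))"

definition cochains ::
    "(nat \<Rightarrow> ('a::{ring,monoid_mult}, 'p) bimodule) \<Rightarrow> int \<Rightarrow> ('p \<Rightarrow> 'a) set" where
  "cochains P d = bimod_hom (cx_obj P d) regular_bimodule"

definition cocycles ::
    "(nat \<Rightarrow> ('a::{ring,monoid_mult}, 'p) bimodule) \<Rightarrow> (nat \<Rightarrow> 'p \<Rightarrow> 'p) \<Rightarrow> int \<Rightarrow> ('p \<Rightarrow> 'a) set"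
  where
  "cocycles P \<delta> d =
    {f \<in> cochains P d. \<forall>v\<in>carrier (cx_obj P (d + 1)). f (cx_diff P \<delta> (d + 1) v) = 0}"

definition coboundaries ::
    "(nat \<Rightarrow> ('a::{ring,monoid_mult}, 'p) bimodule) \<Rightarrow> (nat \<Rightarrow> 'p \<Rightarrow> 'p) \<Rightarrow> int \<Rightarrow> ('p \<Rightarrow> 'a) set"
  where
  "coboundaries P \<delta> d =
    {f \<in> cochains P d. \<exists>g\<in>cochains P (d - 1). \<forall>v\<in>carrier (cx_obj P d). f v = g (cx_diff P \<delta> d v)}"

definition coh_class ::
    "(nat \<Rightarrow> ('a::{ring,monoid_mult}, 'p) bimodule) \<Rightarrow> (nat \<Rightarrow> 'p \<Rightarrow> 'p) \<Rightarrow> int \<Rightarrow>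
      ('p \<Rightarrow> 'a) \<Rightarrow> ('p \<Rightarrow> 'a) set" where
  "coh_class P \<delta> d f = {g \<in> cochains P d. (\<lambda>v. g v - f v) \<in> coboundaries P \<delta> d}"

definition HH ::
    "(nat \<Rightarrow> ('a::{ring,monoid_mult}, 'p) bimodule) \<Rightarrow> (nat \<Rightarrow> 'p \<Rightarrow> 'p) \<Rightarrow> int \<Rightarrow>
      ('p \<Rightarrow> 'a) set set" where
  "HH P \<delta> d = coh_class P \<delta> d ` cocycles P \<delta> d"

text \<open>
  The bracket on cohomology, computed with the comparison morphisms \<open>i\<close> (to the bar resolution) and
  \<open>p\<close> (from it). For \<open>m = n = 0\<close> the truncated index \<open>m + n - 1\<close> is harmless, as
  \<open>bar_bracket\<close> then vanishes.
\<close>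

definition HH_bracket ::
    "('k::field \<Rightarrow> 'a::{ring,monoid_mult} \<Rightarrow> 'a) \<Rightarrow> (nat \<Rightarrow> ('a, 'p) bimodule) \<Rightarrow>
      (nat \<Rightarrow> 'p \<Rightarrow> 'p) \<Rightarrow> (nat \<Rightarrow> 'p \<Rightarrow> ('a, 'k) tensor) \<Rightarrow> (nat \<Rightarrow> ('a, 'k) tensor \<Rightarrow> 'p) \<Rightarrow>
      nat \<Rightarrow> ('p \<Rightarrow> 'a) \<Rightarrow> nat \<Rightarrow> ('p \<Rightarrow> 'a) \<Rightarrow> ('p \<Rightarrow> 'a) set" where
  "HH_bracket s P \<delta> i p m f n g =
    coh_class P \<delta> (int m + int n - 1) (bar_bracket s m (f \<circ> p m) n (g \<circ> p n) \<circ> i (m + n - 1))"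

section \<open>The homotopy associated with a central element\<close>

definition eta :: "(nat \<Rightarrow> ('a, 'p) bimodule) \<Rightarrow> 'a \<Rightarrow> nat \<Rightarrow> 'p \<Rightarrow> 'p" where
  "eta P \<rho> n v = lact (P n) \<rho> v \<ominus>\<^bsub>P n\<^esub> ract (P n) v \<rho>"

definition is_eta_homotopy ::
    "(nat \<Rightarrow> ('a, 'p) bimodule) \<Rightarrow> (nat \<Rightarrow> 'p \<Rightarrow> 'p) \<Rightarrow> 'a \<Rightarrow> (nat \<Rightarrow> 'p \<Rightarrow> 'p) \<Rightarrow> bool" where
  "is_eta_homotopy P \<delta> \<rho> h \<longleftrightarrow>
    (\<forall>n. h n \<in> bimod_hom (P n) (P (Suc n))) \<and>
    (\<forall>v\<in>carrier (P 0). eta P \<rho> 0 v = \<delta> 1 (h 0 v)) \<and>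
    (\<forall>n\<ge>1. \<forall>v\<in>carrier (P n).
       eta P \<rho> n v = h (n - 1) (\<delta> n v) \<oplus>\<^bsub>P n\<^esub> \<delta> (n + 1) (h n v))"

text \<open>The map \<open>h\<^bsub>n-1\<^esub>\<close> into \<open>P n\<close>, with the convention \<open>h\<^bsub>-1\<^esub> = 0\<close>.\<close>

definition h_pred ::
    "(nat \<Rightarrow> ('a, 'p) bimodule) \<Rightarrow> (nat \<Rightarrow> 'p \<Rightarrow> 'p) \<Rightarrow> nat \<Rightarrow> 'p \<Rightarrow> 'p" where
  "h_pred P h n = (if n = 0 then (\<lambda>v. \<zero>\<^bsub>P 0\<^esub>) else h (n - 1))"

end

theory Submission
  imports Defs
begin

text \<open>
  Inserting \<open>\<rho>\<close> with alternating signs between the entries of a tensor gives maps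
  \<open>S\<^sub>n : B\<^sub>n(A) \<rightarrow> B\<^sub>n\<^sub>+\<^sub>1(A)\<close> such that \<open>d S + S d\<close> is \<open>v \<mapsto> \<rho> v - v \<rho>\<close>. A bimodule map on
  \<open>A \<otimes> A\<close> with value \<open>\<rho>\<close> at \<open>1 | 1\<close> is \<open>\<rho>\<close> times the augmentation, so \<open>\<ell>\<^sub>\<rho> i\<^sub>0 p\<^sub>0\<close> again has
  the value \<open>\<rho>\<close> at \<open>1 | 1\<close>, and the bracket with it is composition with \<open>S\<close>: it is represented by
  \<open>\<phi> p S i\<close>. Now \<open>p S i\<close> is a homotopy for \<open>\<eta> p i\<close>, and so is \<open>p i h\<close>. Their difference
  anticommutes with the differentials, hence is null-homotopic, and \<open>p i\<close> is homotopic to the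
  identity by some \<open>k\<close>. Composing with the cocycle \<open>\<phi>\<close> leaves only coboundaries, because
  \<open>\<phi> k \<eta> = 0\<close>: bimodule maps into \<open>A\<close> vanish on the image of \<open>\<eta>\<close>.
\<close>

section \<open>Bimodules and null-homotopies\<close>

text \<open>Two obstacles shape the proof. Tensors are cosets, so a map on them can be evaluated
  only once it is known to respect multilinearity; and the alternating sums in the bar differential
  d and in S are awkward for induction. On representatives both are replaced by recursions on the
  first entry, d(a|b|l) = ab|l - a|d(b|l) and S(a|b|l) = a|\<rho>|b|l - a|S(b|l), which make dS + Sd
  a short induction. The bracket with l turns into composition with S because l has degree 0: one of
  the two compositions is an empty sum, and in the other the sign exponent (n-1)(i-1) becomes
  -(i-1), which gives the alternating signs of S. The last part of the argument rests on the
  splitting \<phi> p S i - \<phi> h = \<phi> D + \<phi> (p i - id) h with D = p S i - p i h. Each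
  summand is a coboundary for its own reason: D is null-homotopic up to the sign conventions of a
  degree one map, and in the other summand \<delta> h can be rewritten by the homotopy equation for
  \<eta>.\<close>

lemma bimod_homI:
  assumes "\<And>v. v \<in> carrier M \<Longrightarrow> f v \<in> carrier N"
    and "\<And>v w. v \<in> carrier M \<Longrightarrow> w \<in> carrier M \<Longrightarrow> f (v \<oplus>\<^bsub>M\<^esub> w) = f v \<oplus>\<^bsub>N\<^esub> f w"
    and "\<And>a v. v \<in> carrier M \<Longrightarrow> f (lact M a v) = lact N a (f v)"
    and "\<And>a v. v \<in> carrier M \<Longrightarrow> f (ract M v a) = ract N (f v) a"
  shows "f \<in> bimod_hom M N"
  using assms by (auto simp: bimod_hom_def)

lemma bimod_homD:
  assumes "f \<in> bimod_hom M N"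
  shows "v \<in> carrier M \<Longrightarrow> f v \<in> carrier N"
    and "v \<in> carrier M \<Longrightarrow> w \<in> carrier M \<Longrightarrow> f (v \<oplus>\<^bsub>M\<^esub> w) = f v \<oplus>\<^bsub>N\<^esub> f w"
    and "v \<in> carrier M \<Longrightarrow> f (lact M a v) = lact N a (f v)"
    and "v \<in> carrier M \<Longrightarrow> f (ract M v a) = ract N (f v) a"
  using assms by (auto simp: bimod_hom_def)

lemma bimod_hom_comp:
  assumes "f \<in> bimod_hom M N" "g \<in> bimod_hom L M"
  shows "(\<lambda>v. f (g v)) \<in> bimod_hom L N"
  by (rule bimod_homI) (simp_all add: bimod_homD[OF assms(1)] bimod_homD[OF assms(2)])

lemma bimod_hom_id: "(\<lambda>v. v) \<in> bimod_hom M M"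
  by (rule bimod_homI) simp_all

lemma regular_bimodule_simps [simp]:
  "carrier regular_bimodule = UNIV" "a \<oplus>\<^bsub>regular_bimodule\<^esub> b = a + b"
  "lact regular_bimodule a b = a * b" "ract regular_bimodule a b = a * b"
  "\<zero>\<^bsub>regular_bimodule\<^esub> = 0"
  by (simp_all add: regular_bimodule_def)

lemma (in abelian_group) add_self_eq_zero:
  assumes "x \<in> carrier G" "x \<oplus> x = x"
  shows "x = \<zero>"
  using assms by (metis add.l_cancel_one)

lemma (in abelian_group) minus_unique:
  assumes "x \<in> carrier G" "y \<in> carrier G" "z \<in> carrier G" "x = y \<oplus> z"
  shows "x \<ominus> z = y"
  using assms by (simp add: minus_eq a_assoc r_neg)

lemma (in abelian_group) minus_add_cancel:
  assumes "x \<in> carrier G" "y \<in> carrier G"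
  shows "(x \<ominus> y) \<oplus> y = x" "y \<oplus> (x \<ominus> y) = x"
  using assms by (simp_all add: minus_eq a_assoc l_neg a_comm[of y])

lemma bimod_hom_zero:
  assumes "abelian_group M" "abelian_group N" "f \<in> bimod_hom M N"
  shows "f \<zero>\<^bsub>M\<^esub> = \<zero>\<^bsub>N\<^esub>"
proof -
  interpret M: abelian_group M by fact
  interpret N: abelian_group N by fact
  show ?thesis
    by (rule N.add_self_eq_zero)
      (use bimod_homD[OF assms(3)] in \<open>simp_all flip: bimod_homD(2)[OF assms(3)]\<close>)
qed

lemma bimod_hom_minus:
  assumes "abelian_group M" "abelian_group N" "f \<in> bimod_hom M N"
    and "v \<in> carrier M" "w \<in> carrier M"
  shows "f (v \<ominus>\<^bsub>M\<^esub> w) = f v \<ominus>\<^bsub>N\<^esub> f w"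
proof -
  interpret M: abelian_group M by fact
  interpret N: abelian_group N by fact
  show ?thesis
    by (rule N.minus_unique[symmetric])
      (use assms(4,5) in \<open>simp_all add: bimod_homD(1)[OF assms(3)] M.minus_add_cancel
        flip: bimod_homD(2)[OF assms(3)]\<close>)
qed

lemma abelian_group_regular: "abelian_group (regular_bimodule :: ('a::{ring,monoid_mult}, 'a) bimodule)"
proof (rule abelian_groupI)
  fix x :: 'a
  show "\<exists>y\<in>carrier regular_bimodule. y \<oplus>\<^bsub>regular_bimodule\<^esub> x = \<zero>\<^bsub>regular_bimodule\<^esub>"
    by (auto intro: exI[of _ "- x"])
qed (auto simp: add_ac)

lemma regular_minus [simp]: "(a::'a::{ring,monoid_mult}) \<ominus>\<^bsub>regular_bimodule\<^esub> b = a - b"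
proof -
  interpret abelian_group "regular_bimodule :: ('a, 'a) bimodule"
    by (rule abelian_group_regular)
  show ?thesis by (rule minus_unique) auto
qed

context bimodule
begin

lemma act_zero [simp]: "lact M a \<zero> = \<zero>" "ract M \<zero> a = \<zero>"
  by (rule add_self_eq_zero; simp add: lact_closed ract_closed flip: lact_add ract_add)+

lemma act_minus:
  assumes "v \<in> carrier M" "w \<in> carrier M"
  shows "lact M a (v \<ominus> w) = lact M a v \<ominus> lact M a w"
    and "ract M (v \<ominus> w) a = ract M v a \<ominus> ract M w a"
  by (rule minus_unique[symmetric];
      use assms in \<open>simp add: lact_closed ract_closed minus_add_cancel flip: lact_add ract_add\<close>)+

lemma minus_add_minus:
  assumes "a \<in> carrier M" "b \<in> carrier M" "c \<in> carrier M" "d \<in> carrier M"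
  shows "(a \<oplus> b) \<ominus> (c \<oplus> d) = (a \<ominus> c) \<oplus> (b \<ominus> d)"
  using assms by (simp add: minus_eq minus_add a_ac)

lemma hom_minus_closed:
  assumes "f \<in> bimod_hom L M" "g \<in> bimod_hom L M"
  shows "(\<lambda>v. f v \<ominus> g v) \<in> bimod_hom L M"
  by (rule bimod_homI)
    (simp_all add: bimod_homD[OF assms(1)] bimod_homD[OF assms(2)] minus_add_minus act_minus)

lemma minus_minus_cancel_left:
  assumes "a \<in> carrier M" "b \<in> carrier M" "c \<in> carrier M"
  shows "(a \<ominus> b) \<ominus> (a \<ominus> c) = \<ominus> (b \<ominus> c)"
  using minus_add_minus[of a "\<ominus> b" a "\<ominus> c"] assms by (simp add: minus_eq minus_add r_neg)

text \<open>The morphism axioms evaluate only at sums and actions of carrier elements, and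
  \<open>M\<close> keeps these in its carrier. This serves maps such as the bracket, whose closed
  formula is known on the carrier alone.\<close>

lemma bimod_hom_cong:
  assumes "f \<in> bimod_hom M N" "\<And>v. v \<in> carrier M \<Longrightarrow> g v = f v"
  shows "g \<in> bimod_hom M N"
  using bimod_homD[OF assms(1)] assms(2)
  by (intro bimod_homI) (simp_all add: lact_closed ract_closed)

lemma hom_uminus_closed:
  assumes f: "f \<in> bimod_hom L M"
  shows "(\<lambda>v. \<ominus> f v) \<in> bimod_hom L M"
proof -
  have "lact M a (\<ominus> v) = \<ominus> lact M a v" "ract M (\<ominus> v) a = \<ominus> ract M v a" if "v \<in> carrier M" for a v
    using act_minus[of \<zero> v a] that by (simp_all add: minus_eq lact_closed ract_closed)
  with bimod_homD[OF f] show ?thesis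
    by (intro bimod_homI) (simp_all add: minus_add)
qed

text \<open>Closure under differences already yields zero, negatives and sums. The intended
  \<open>N\<close> is the image of a morphism.\<close>

lemma sub_bimodule:
  assumes N: "N \<subseteq> carrier M" "N \<noteq> {}"
    and cl: "\<And>v w. v \<in> N \<Longrightarrow> w \<in> N \<Longrightarrow> v \<ominus> w \<in> N"
    and "\<And>a v. v \<in> N \<Longrightarrow> lact M a v \<in> N" "\<And>a v. v \<in> N \<Longrightarrow> ract M v a \<in> N"
  shows "bimodule s (M\<lparr>carrier := N\<rparr>)"
proof -
  have z: "\<zero> \<in> N"
    using N cl by (metis all_not_in_conv subsetD r_neg minus_eq)
  have neg: "\<ominus> v \<in> N" if "v \<in> N" for v
    using cl[OF z that] N that by (auto simp: minus_eq)
  have add: "v \<oplus> w \<in> N" if "v \<in> N" "w \<in> N" for v w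
    using cl[OF that(1) neg[OF that(2)]] N that by (auto simp: minus_eq)
  have "abelian_group (M\<lparr>carrier := N\<rparr>)"
  proof (rule abelian_groupI)
    fix x assume "x \<in> carrier (M\<lparr>carrier := N\<rparr>)"
    then show "\<exists>y\<in>carrier (M\<lparr>carrier := N\<rparr>). y \<oplus>\<^bsub>M\<lparr>carrier := N\<rparr>\<^esub> x = \<zero>\<^bsub>M\<lparr>carrier := N\<rparr>\<^esub>"
      using neg N by (auto intro!: bexI[of _ "\<ominus> x"] l_neg)
  qed (use N in \<open>auto simp: z add a_assoc subsetD intro: a_comm\<close>)
  then show ?thesis
    unfolding bimodule_def bimodule_axioms_def
    using assms by (simp add: lact_add ract_add add_lact add_ract lact_mult ract_mult lact_one
        ract_one lact_ract scale_central subset_iff)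
qed

end

text \<open>Transport of structure along an injection. \<open>projective_bimodule\<close> quantifies
  over test bimodules in one fixed type, so bimodules of another type have to be copied into it
  first.\<close>

definition transport_bimodule :: "('m \<Rightarrow> 'n) \<Rightarrow> ('a, 'm) bimodule \<Rightarrow> ('a, 'n) bimodule" where
  "transport_bimodule \<iota> M =
    \<lparr>carrier = \<iota> ` carrier M, mult = undefined, one = undefined, zero = \<iota> \<zero>\<^bsub>M\<^esub>,
     add = (\<lambda>x y. \<iota> (inv_into UNIV \<iota> x \<oplus>\<^bsub>M\<^esub> inv_into UNIV \<iota> y)),
     lact = (\<lambda>a x. \<iota> (lact M a (inv_into UNIV \<iota> x))), ract = (\<lambda>x a. \<iota> (ract M (inv_into UNIV \<iota> x) a))\<rparr>"

lemma bimodule_transport: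
  assumes "inj \<iota>" "bimodule s M"
  shows "bimodule s (transport_bimodule \<iota> M)"
proof -
  interpret M: bimodule s M by fact
  note [simp] = transport_bimodule_def inv_f_f[OF assms(1)] inj_eq[OF assms(1)]
  have "abelian_group (transport_bimodule \<iota> M)"
  proof (rule abelian_groupI)
    fix x assume "x \<in> carrier (transport_bimodule \<iota> M)"
    then obtain v where v: "v \<in> carrier M" "x = \<iota> v"
      by auto
    then show "\<exists>y\<in>carrier (transport_bimodule \<iota> M).
        y \<oplus>\<^bsub>transport_bimodule \<iota> M\<^esub> x = \<zero>\<^bsub>transport_bimodule \<iota> M\<^esub>"
      by (auto intro!: bexI[of _ "\<ominus>\<^bsub>M\<^esub> v"] M.l_neg)
  qed (auto simp: M.a_assoc intro: M.a_comm)
  then show ?thesis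
    unfolding bimodule_def bimodule_axioms_def
    by (auto simp: M.lact_add M.ract_add M.add_lact M.add_ract M.lact_mult M.ract_mult M.lact_one
        M.ract_one M.lact_ract M.scale_central M.lact_closed M.ract_closed)
qed

text \<open>Cutting \<open>N\<close> down to the image of \<open>g\<close> makes \<open>g\<close>
  surjective, and \<open>im\<close> says that \<open>f\<close> still lands there. Exactness of a
  complex provides just such an inclusion of images.\<close>

lemma projective_bimodule_lift:
  fixes Q M N :: "('a::{ring,monoid_mult}, 'm) bimodule" and s :: "'k::field \<Rightarrow> 'a \<Rightarrow> 'a"
  assumes Q: "projective_bimodule s Q" and M: "bimodule s M" and N: "bimodule s N"
    and g: "g \<in> bimod_hom M N" and f: "f \<in> bimod_hom Q N"
    and im: "f ` carrier Q \<subseteq> g ` carrier M"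
  shows "\<exists>h\<in>bimod_hom Q M. \<forall>v\<in>carrier Q. g (h v) = f v"
proof -
  interpret M: bimodule s M by fact
  interpret N: bimodule s N by fact
  \<comment> \<open>Copies of the given bimodules in the type that the definition of projectivity allows.\<close>
  define \<iota> :: "'m \<Rightarrow> ('a \<times> 'm \<times> 'a) \<Rightarrow>\<^sub>0 'k" where "\<iota> v = Poly_Mapping.single (0, v, 0) 1" for v
  have inj: "inj \<iota>"
    by (rule injI) (auto simp: \<iota>_def dest: arg_cong[of _ _ Poly_Mapping.keys])
  note [simp] = transport_bimodule_def inv_f_f[OF inj] inj_eq[OF inj]
  define I where "I = N\<lparr>carrier := g ` carrier M\<rparr>"
  have I: "bimodule s I"
    unfolding I_def
  proof (rule N.sub_bimodule)
    show "g ` carrier M \<noteq> {}"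
      by auto
    show "v \<ominus>\<^bsub>N\<^esub> w \<in> g ` carrier M" if "v \<in> g ` carrier M" "w \<in> g ` carrier M" for v w
      using that
      by (auto simp flip: bimod_hom_minus[OF M.abelian_group_axioms N.abelian_group_axioms g])
  qed (auto simp: M.lact_closed M.ract_closed bimod_homD(1)[OF g]
      simp flip: bimod_homD(3,4)[OF g])
  let ?M = "transport_bimodule \<iota> M" and ?I = "transport_bimodule \<iota> I"
  have g': "(\<lambda>x. \<iota> (g (inv_into UNIV \<iota> x))) \<in> bimod_hom ?M ?I"
    by (rule bimod_homI) (auto simp: I_def bimod_homD[OF g])
  have f': "(\<lambda>v. \<iota> (f v)) \<in> bimod_hom Q ?I"
    by (rule bimod_homI) (use im in \<open>auto simp: I_def bimod_homD[OF f]\<close>)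
  have eq: "bimodule s ?M \<and> bimodule s ?I \<and> (\<lambda>x. \<iota> (g (inv_into UNIV \<iota> x))) ` carrier ?M = carrier ?I"
    using bimodule_transport[OF inj M] bimodule_transport[OF inj I]
    by (auto simp: I_def image_iff)
  have "\<exists>h\<in>bimod_hom Q ?M. \<forall>v\<in>carrier Q. \<iota> (g (inv_into UNIV \<iota> (h v))) = \<iota> (f v)"
    by (rule Q[unfolded projective_bimodule_def, THEN conjunct2, rule_format, OF g' f' eq])
  then obtain h where h: "h \<in> bimod_hom Q ?M"
    "\<forall>v\<in>carrier Q. \<iota> (g (inv_into UNIV \<iota> (h v))) = \<iota> (f v)"
    by blast
  have "inv_into UNIV \<iota> (h v) \<in> carrier M" if "v \<in> carrier Q" for v
    using bimod_homD(1)[OF h(1) that] by auto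
  then have "(\<lambda>v. inv_into UNIV \<iota> (h v)) \<in> bimod_hom Q M"
    by (intro bimod_homI) (simp_all add: bimod_homD(2-4)[OF h(1)])
  with h(2) show ?thesis
    by (intro bexI[of _ "\<lambda>v. inv_into UNIV \<iota> (h v)"]) auto
qed

text \<open>The usual recursion: each new map lifts f - u \<delta> through d. Exactness of
  \<open>Q\<close> is asked for from degree 1 on and degree 0 is governed by \<open>f0\<close>
  instead of an augmentation, so that the lemma applies both to the resolution and to its
  shift.\<close>

lemma chain_map_null_homotopic:
  fixes P Q :: "nat \<Rightarrow> ('a::{ring,monoid_mult}, 'm) bimodule"
  assumes P: "\<And>n. projective_bimodule s (P n)"
    and \<delta>: "\<And>n. \<delta> (Suc n) \<in> bimod_hom (P (Suc n)) (P n)"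
    and \<delta>\<delta>: "\<And>n v. v \<in> carrier (P (Suc (Suc n))) \<Longrightarrow> \<delta> (Suc n) (\<delta> (Suc (Suc n)) v) = \<zero>\<^bsub>P n\<^esub>"
    and Q: "\<And>n. bimodule s (Q n)"
    and d: "\<And>n. d (Suc n) \<in> bimod_hom (Q (Suc n)) (Q n)"
    and exact: "\<And>n v. v \<in> carrier (Q (Suc n)) \<Longrightarrow> d (Suc n) v = \<zero>\<^bsub>Q n\<^esub> \<Longrightarrow>
      v \<in> d (Suc (Suc n)) ` carrier (Q (Suc (Suc n)))"
    and f: "\<And>n. f n \<in> bimod_hom (P n) (Q n)"
    and chain: "\<And>n v. v \<in> carrier (P (Suc n)) \<Longrightarrow> d (Suc n) (f (Suc n) v) = f n (\<delta> (Suc n) v)"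
    and f0: "f 0 ` carrier (P 0) \<subseteq> d 1 ` carrier (Q 1)"
  obtains u where "\<And>n. u n \<in> bimod_hom (P n) (Q (Suc n))"
    and "\<And>v. v \<in> carrier (P 0) \<Longrightarrow> f 0 v = d 1 (u 0 v)"
    and "\<And>n v. v \<in> carrier (P (Suc n)) \<Longrightarrow>
      f (Suc n) v = u n (\<delta> (Suc n) v) \<oplus>\<^bsub>Q (Suc n)\<^esub> d (Suc (Suc n)) (u (Suc n) v)"
proof -
  \<comment> \<open>The equation d u = f on the image of \<delta> keeps the recursion going: it puts
    f - u \<delta> in the next degree into the kernel of d. The clause for n = 0 records the initial
    homotopy equation, which \<open>?B\<close> does not cover.\<close>
  let ?A = "\<lambda>n u. u \<in> bimod_hom (P n) (Q (Suc n)) \<and>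
    (\<forall>v\<in>carrier (P (Suc n)). d (Suc n) (u (\<delta> (Suc n) v)) = f n (\<delta> (Suc n) v)) \<and>
    (n = 0 \<longrightarrow> (\<forall>v\<in>carrier (P 0). f 0 v = d 1 (u v)))"
  let ?B = "\<lambda>n u u'. \<forall>v\<in>carrier (P (Suc n)).
    f (Suc n) v = u (\<delta> (Suc n) v) \<oplus>\<^bsub>Q (Suc n)\<^esub> d (Suc (Suc n)) (u' v)"
  have PB: "bimodule s (P n)" for n
    using P by (simp add: projective_bimodule_def)
  note ag = bimodule.axioms(1)[OF PB] bimodule.axioms(1)[OF Q]
  have "\<exists>u. \<forall>n. ?A n (u n) \<and> ?B n (u n) (u (Suc n))"
  proof (rule dependent_nat_choice)
    obtain u where "u \<in> bimod_hom (P 0) (Q 1)" "\<forall>v\<in>carrier (P 0). d 1 (u v) = f 0 v"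
      using projective_bimodule_lift[OF P Q Q _ f f0] d[of 0] by auto
    then show "\<exists>u. ?A 0 u"
      using bimod_homD(1)[OF \<delta>[of 0]] by auto
  next
    fix u n
    assume u: "?A n u"
    interpret Q: bimodule s "Q (Suc n)" by (rule Q)
    interpret Q0: bimodule s "Q n" by (rule Q)
    have u1: "u \<in> bimod_hom (P n) (Q (Suc n))" and
      u2: "\<And>v. v \<in> carrier (P (Suc n)) \<Longrightarrow> d (Suc n) (u (\<delta> (Suc n) v)) = f n (\<delta> (Suc n) v)"
      using u by auto
    let ?g = "\<lambda>v. f (Suc n) v \<ominus>\<^bsub>Q (Suc n)\<^esub> u (\<delta> (Suc n) v)"
    have g: "?g \<in> bimod_hom (P (Suc n)) (Q (Suc n))"
      by (rule Q.hom_minus_closed[OF f bimod_hom_comp[OF u1 \<delta>]])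
    have "?g v \<in> d (Suc (Suc n)) ` carrier (Q (Suc (Suc n)))" if v: "v \<in> carrier (P (Suc n))" for v
    proof (rule exact)
      have fc: "f n (\<delta> (Suc n) v) \<in> carrier (Q n)"
        using bimod_homD(1)[OF f bimod_homD(1)[OF \<delta> v]] .
      have "d (Suc n) (?g v) = d (Suc n) (f (Suc n) v) \<ominus>\<^bsub>Q n\<^esub> d (Suc n) (u (\<delta> (Suc n) v))"
        using bimod_homD(1)[OF f v] bimod_homD(1)[OF u1 bimod_homD(1)[OF \<delta> v]]
        by (rule bimod_hom_minus[OF ag(2) ag(2) d])
      then show "d (Suc n) (?g v) = \<zero>\<^bsub>Q n\<^esub>"
        using fc by (simp add: chain u2 v Q0.r_neg Q0.minus_eq)
    qed (rule bimod_homD(1)[OF g v])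
    then obtain u' where u': "u' \<in> bimod_hom (P (Suc n)) (Q (Suc (Suc n)))"
      "\<forall>v\<in>carrier (P (Suc n)). d (Suc (Suc n)) (u' v) = ?g v"
      using projective_bimodule_lift[OF P Q Q d g] by blast
    have B: "f (Suc n) v = u (\<delta> (Suc n) v) \<oplus>\<^bsub>Q (Suc n)\<^esub> d (Suc (Suc n)) (u' v)"
      if v: "v \<in> carrier (P (Suc n))" for v
      using u'(2) v bimod_homD(1)[OF f v] bimod_homD(1)[OF u1 bimod_homD(1)[OF \<delta> v]]
      by (simp add: Q.minus_add_cancel)
    \<comment> \<open>At \<delta> v the summand u (\<delta> (\<delta> v)) of \<open>B\<close> is
      zero, which leaves the invariant for \<open>u'\<close>.\<close>
    have "d (Suc (Suc n)) (u' (\<delta> (Suc (Suc n)) v)) = f (Suc n) (\<delta> (Suc (Suc n)) v)"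
      if v: "v \<in> carrier (P (Suc (Suc n)))" for v
      using B[OF bimod_homD(1)[OF \<delta> v]] bimod_hom_zero[OF ag u1]
        bimod_homD(1)[OF d bimod_homD(1)[OF u'(1) bimod_homD(1)[OF \<delta> v]]]
      by (simp add: \<delta>\<delta> v)
    with u'(1) B show "\<exists>u'. ?A (Suc n) u' \<and> ?B n u u'"
      by blast
  qed
  then show ?thesis
    using that by (metis (no_types, lifting))
qed

text \<open>Left multiplication by \<rho> commutes with the left action because \<rho> is central
  and with the right action by the bimodule law; right multiplication by \<rho> is
  symmetric.\<close>

lemma (in bimodule) commutator_hom:
  assumes "\<And>a. \<rho> * a = a * \<rho>"
  shows "(\<lambda>v. lact M \<rho> v \<ominus> ract M v \<rho>) \<in> bimod_hom M M"
  by (rule bimod_homI)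
    (simp_all add: act_minus lact_closed ract_closed lact_add ract_add minus_add_minus
      lact_ract assms flip: lact_mult ract_mult)

section \<open>Multilinear maps on tensor powers\<close>

text \<open>Names the sum inside \<open>tensor_map\<close> and \<open>tensor_lift\<close>, so that
  maps on tensors can be computed on representatives.\<close>

definition linext :: "('k::field \<Rightarrow> 'b::ab_group_add \<Rightarrow> 'b) \<Rightarrow> ('x \<Rightarrow> 'b) \<Rightarrow> ('x \<Rightarrow>\<^sub>0 'k) \<Rightarrow> 'b" where
  "linext T \<psi> x = (\<Sum>l\<in>Poly_Mapping.keys x. T (Poly_Mapping.lookup x l) (\<psi> l))"

lemma lookup_fscale [simp]:
  "Poly_Mapping.lookup (fscale c x) l = c * Poly_Mapping.lookup x l"
  by (simp add: fscale_def Poly_Mapping.map.rep_eq when_def)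

lemma fscale_single [simp]: "fscale c (Poly_Mapping.single l d) = Poly_Mapping.single l (c * d)"
  by (rule poly_mapping_eqI) (simp add: lookup_single when_def)

interpretation fs: vector_space "fscale :: 'k::field \<Rightarrow> ('x \<Rightarrow>\<^sub>0 'k) \<Rightarrow> ('x \<Rightarrow>\<^sub>0 'k)"
  by unfold_locales (auto intro!: poly_mapping_eqI simp: lookup_add algebra_simps)

lemma linext_cong:
  assumes "\<And>l. l \<in> Poly_Mapping.keys x \<Longrightarrow> \<psi> l = \<psi>' l"
  shows "linext T \<psi> x = linext T \<psi>' x"
  using assms by (simp add: linext_def)

lemma sum_single_eq:
  "(\<Sum>l\<in>Poly_Mapping.keys x. fscale (Poly_Mapping.lookup x l) (Poly_Mapping.single l 1)) = x"
  by (rule poly_mapping_eqI)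
    (auto simp: lookup_sum lookup_single when_def sum.delta in_keys_iff)

context vector_space
begin

lemma linext_superset:
  assumes "finite K" "Poly_Mapping.keys x \<subseteq> K"
  shows "linext scale \<psi> x = (\<Sum>l\<in>K. scale (Poly_Mapping.lookup x l) (\<psi> l))"
  unfolding linext_def
  by (rule sum.mono_neutral_left) (use assms in \<open>auto simp: in_keys_iff\<close>)

lemma linext_add: "linext scale \<psi> (x + y) = linext scale \<psi> x + linext scale \<psi> y"
proof -
  let ?K = "Poly_Mapping.keys x \<union> Poly_Mapping.keys y"
  have "linext scale \<psi> z = (\<Sum>l\<in>?K. scale (Poly_Mapping.lookup z l) (\<psi> l))"
    if "z \<in> {x, y, x + y}" for z
    by (rule linext_superset) (use that Poly_Mapping.keys_add[of x y] in auto)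
  then show ?thesis
    by (simp add: lookup_add scale_left_distrib sum.distrib)
qed

lemma linext_scale: "linext scale \<psi> (fscale c x) = scale c (linext scale \<psi> x)"
proof -
  have "linext scale \<psi> (fscale c x) =
      (\<Sum>l\<in>Poly_Mapping.keys x. scale (Poly_Mapping.lookup (fscale c x) l) (\<psi> l))"
    by (rule linext_superset) (auto simp: in_keys_iff)
  then show ?thesis
    by (simp add: linext_def scale_sum_right)
qed

lemma linext_single [simp]: "linext scale \<psi> (Poly_Mapping.single l c) = scale c (\<psi> l)"
  by (subst linext_superset[of "{l}"]) auto

lemma linext_zero [simp]: "linext scale \<psi> 0 = 0"
  by (simp add: linext_def)

lemma linext_uminus: "linext scale \<psi> (- x) = - linext scale \<psi> x"
  using linext_add[of \<psi> x "- x"] by (simp add: add_eq_0_iff)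

lemma linext_diff: "linext scale \<psi> (x - y) = linext scale \<psi> x - linext scale \<psi> y"
  using linext_add[of \<psi> x "- y"] by (simp add: linext_uminus)

lemma linext_sum: "linext scale \<psi> (sum h I) = (\<Sum>i\<in>I. linext scale \<psi> (h i))"
  by (induction I rule: infinite_finite_induct) (simp_all add: linext_add)

lemma linext_linext:
  "linext scale \<phi> (linext fscale \<psi> x) = linext scale (\<lambda>l. linext scale \<phi> (\<psi> l)) x"
  by (simp add: linext_def[of fscale] linext_def[of _ _ x] linext_sum linext_scale)

lemma linext_diff_fun:
  "linext scale (\<lambda>l. \<phi> l - \<psi> l) x = linext scale \<phi> x - linext scale \<psi> x"
  by (simp add: linext_def scale_right_diff_distrib sum_subtractf)

end

lemma linext_fscale_single [simp]: "linext fscale (\<lambda>l. Poly_Mapping.single l 1) x = x"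
  by (simp only: linext_def sum_single_eq)

text \<open>Working modulo \<open>R\<close> treats both kinds of maps out of a tensor power at once:
  \<open>R = {0}\<close> for values in the algebra, \<open>R = tensor_rel s m\<close> for values
  given as representatives in the m-th tensor power.\<close>

definition multilinear_mod ::
    "('k::field \<Rightarrow> 'a::{ring,monoid_mult} \<Rightarrow> 'a) \<Rightarrow> ('k \<Rightarrow> 'b::ab_group_add \<Rightarrow> 'b) \<Rightarrow> 'b set \<Rightarrow>
      nat \<Rightarrow> ('a list \<Rightarrow> 'b) \<Rightarrow> bool" where
  "multilinear_mod s T R n \<psi> \<longleftrightarrow> (\<forall>us vs. length us + 1 + length vs = n \<longrightarrow>
    (\<forall>a b. \<psi> (us @ [a + b] @ vs) - \<psi> (us @ [a] @ vs) - \<psi> (us @ [b] @ vs) \<in> R) \<and>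
    (\<forall>c a. \<psi> (us @ [s c a] @ vs) - T c (\<psi> (us @ [a] @ vs)) \<in> R))"

text \<open>Operations on words in which varying one entry of the argument varies just one entry of
  the result, and linearly so. Composition with them preserves multilinearity, which handles faces,
  insertions and outer multiplications uniformly.\<close>

definition slotwise_linear ::
    "('k::field \<Rightarrow> 'a::{ring,monoid_mult} \<Rightarrow> 'a) \<Rightarrow> nat \<Rightarrow> nat \<Rightarrow> ('a list \<Rightarrow> 'a list) \<Rightarrow> bool" where
  "slotwise_linear s n m F \<longleftrightarrow> (\<forall>us vs. length us + 1 + length vs = n \<longrightarrow>
    (\<exists>us' vs' g. length us' + 1 + length vs' = m \<and> (\<forall>x. F (us @ [x] @ vs) = us' @ [g x] @ vs') \<and>
      (\<forall>x y. g (x + y) = g x + g y) \<and> (\<forall>c x. g (s c x) = s c (g x))))"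

lemma slotwise_linearI:
  assumes "\<And>us vs. length us + 1 + length vs = n \<Longrightarrow>
    \<exists>us' vs' g. length us' + 1 + length vs' = m \<and> (\<forall>x. F (us @ [x] @ vs) = us' @ [g x] @ vs') \<and>
      (\<forall>x y. g (x + y) = g x + g y) \<and> (\<forall>c x. g (s c x) = s c (g x))"
  shows "slotwise_linear s n m F"
  using assms unfolding slotwise_linear_def by blast

lemma multilinear_mod_compose:
  fixes s :: "'k::field \<Rightarrow> 'a::{ring,monoid_mult} \<Rightarrow> 'a"
  assumes "multilinear_mod s T R m \<psi>" "slotwise_linear s n m F"
  shows "multilinear_mod s T R n (\<lambda>l. \<psi> (F l))"
  unfolding multilinear_mod_def
proof (intro allI impI)
  fix us vs :: "'a list"
  assume "length us + 1 + length vs = n"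
  with assms(2) obtain us' vs' g where *: "length us' + 1 + length vs' = m"
      "\<And>x. F (us @ [x] @ vs) = us' @ [g x] @ vs'"
      "\<And>x y. g (x + y) = g x + g y" "\<And>c x. g (s c x) = s c (g x)"
    unfolding slotwise_linear_def by blast
  show "(\<forall>a b. \<psi> (F (us @ [a + b] @ vs)) - \<psi> (F (us @ [a] @ vs)) - \<psi> (F (us @ [b] @ vs)) \<in> R) \<and>
    (\<forall>c a. \<psi> (F (us @ [s c a] @ vs)) - T c (\<psi> (F (us @ [a] @ vs))) \<in> R)"
    using assms(1) *(1) unfolding multilinear_mod_def *(2-4) by blast
qed

lemma multilinear_mod_cong:
  assumes "\<And>l. length l = n \<Longrightarrow> \<psi> l = \<psi>' l"
  shows "multilinear_mod s T R n \<psi> \<longleftrightarrow> multilinear_mod s T R n \<psi>'"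
  using assms by (simp add: multilinear_mod_def)

lemma multilinear_mod_sum:
  assumes "vector_space T" "module.subspace T R"
    and "\<And>i. i \<in> I \<Longrightarrow> multilinear_mod s T R n (\<psi> i)"
  shows "multilinear_mod s T R n (\<lambda>l. \<Sum>i\<in>I. T (c i) (\<psi> i l))"
proof -
  interpret T: vector_space T by fact
  have 1: "(\<Sum>i\<in>I. T (c i) (x i)) - (\<Sum>i\<in>I. T (c i) (y i)) - (\<Sum>i\<in>I. T (c i) (z i)) =
      (\<Sum>i\<in>I. T (c i) (x i - y i - z i))" for x y z
    by (simp add: T.scale_right_diff_distrib sum_subtractf)
  have 2: "(\<Sum>i\<in>I. T (c i) (x i)) - T e (\<Sum>i\<in>I. T (c i) (y i)) =
      (\<Sum>i\<in>I. T (c i) (x i - T e (y i)))" for x y e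
    by (simp add: T.scale_right_diff_distrib sum_subtractf T.scale_sum_right mult.commute)
  show ?thesis
    unfolding multilinear_mod_def 1 2
    using assms(3) unfolding multilinear_mod_def
    by (intro allI impI conjI T.subspace_sum[OF assms(2)] T.subspace_scale[OF assms(2)]) blast+
qed

lemma tensor_rel_subspace: "fs.subspace (tensor_rel s n)"
  by (simp add: tensor_rel_def)

text \<open>The universal multilinear map: its two conditions are the two families of generators of
  \<open>tensor_rel\<close>. Composed with a slotwise linear operation it lets that operation
  descend to tensor powers.\<close>

lemma multilinear_mod_single:
  "multilinear_mod s fscale (tensor_rel s n) n (\<lambda>l. Poly_Mapping.single l 1)"
  unfolding multilinear_mod_def tensor_rel_def
  by (intro allI impI conjI fs.span_base) (simp, blast)+

text \<open>Well-definedness on cosets: multilinearity sends the generators of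
  \<open>tensor_rel\<close> into the subspace \<open>R\<close>, hence also their span.\<close>

lemma linext_tensor_rel:
  assumes T: "vector_space T" "module.subspace T R"
    and \<psi>: "multilinear_mod s T R n \<psi>" and x: "x \<in> tensor_rel s n"
  shows "linext T \<psi> x \<in> R"
proof -
  interpret T: vector_space T by fact
  note sub = T.subspace_0[OF T(2)] T.subspace_add[OF T(2)] T.subspace_scale[OF T(2)]
  show ?thesis
    using x unfolding tensor_rel_def
  proof (rule fs.span_induct)
    show "fs.subspace {x. linext T \<psi> x \<in> R}"
      by (auto intro!: fs.subspaceI simp: T.linext_add T.linext_scale sub)
  qed (use \<psi> in \<open>auto simp: multilinear_mod_def T.linext_diff\<close>)
qed

lemma tcoset_eq_iff: "tcoset s n x = tcoset s n y \<longleftrightarrow> x - y \<in> tensor_rel s n"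
proof
  assume "tcoset s n x = tcoset s n y"
  moreover have "x \<in> tcoset s n x"
    by (auto simp: tcoset_def intro!: exI[of _ 0] fs.subspace_0 tensor_rel_subspace)
  ultimately show "x - y \<in> tensor_rel s n"
    by (auto simp: tcoset_def)
next
  assume *: "x - y \<in> tensor_rel s n"
  have "tcoset s n x \<subseteq> tcoset s n y" if "x - y \<in> tensor_rel s n" for x y
  proof
    fix z assume "z \<in> tcoset s n x"
    then obtain r where "r \<in> tensor_rel s n" "z = x + r"
      by (auto simp: tcoset_def)
    then have "x - y + r \<in> tensor_rel s n" "z = y + (x - y + r)"
      using that fs.subspace_add[OF tensor_rel_subspace] by auto
    then show "z \<in> tcoset s n y"
      unfolding tcoset_def by blast
  qed
  from this[OF *] this[of y x] show "tcoset s n x = tcoset s n y"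
    using fs.subspace_neg[OF tensor_rel_subspace *] by auto
qed

lemma mem_tcoset_iff: "y \<in> tcoset s n x \<longleftrightarrow> y - x \<in> tensor_rel s n"
  by (auto simp: tcoset_def intro!: exI[of _ "y - x"])

lemma self_mem_tcoset: "x \<in> tcoset s n x"
  by (simp add: mem_tcoset_iff fs.subspace_0[OF tensor_rel_subspace])

text \<open>The \<open>THE\<close> in \<open>tensor_lift\<close> is proper: all representatives give
  the same value, and a coset has at least one.\<close>

lemma tensor_lift_tcoset:
  assumes "vector_space s" "multilinear_mod s s {0} n \<psi>"
  shows "tensor_lift s \<psi> (tcoset s n x) = linext s \<psi> x"
proof -
  interpret vector_space s by fact
  have "linext s \<psi> y = linext s \<psi> x" if "y \<in> tcoset s n x" for y
    using linext_tensor_rel[OF assms(1) _ assms(2), of "y - x"] that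
    by (simp add: mem_tcoset_iff linext_diff)
  then show ?thesis
    unfolding tensor_lift_def linext_def[symmetric]
    by (intro the_equality) (auto intro: self_mem_tcoset)
qed

lemma tensor_lift_pure:
  assumes "vector_space s" "multilinear_mod s s {0} (length l) \<psi>"
  shows "tensor_lift s \<psi> (pure_tensor s l) = \<psi> l"
proof -
  interpret vector_space s by fact
  show ?thesis
    by (simp add: pure_tensor_def tensor_lift_tcoset[OF assms])
qed

text \<open>The union in \<open>tensor_map\<close> runs over representatives that all produce the
  same coset.\<close>

lemma tensor_map_tcoset:
  assumes "multilinear_mod s fscale (tensor_rel s m) n \<psi>"
  shows "tensor_map s m \<psi> (tcoset s n x) = tcoset s m (linext fscale \<psi> x)"
proof -
  have "tcoset s m (linext fscale \<psi> y) = tcoset s m (linext fscale \<psi> x)" if "y \<in> tcoset s n x" for y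
    using linext_tensor_rel[OF fs.vector_space_axioms tensor_rel_subspace assms, of "y - x"] that
    by (simp add: mem_tcoset_iff tcoset_eq_iff fs.linext_diff)
  then show ?thesis
    unfolding tensor_map_def linext_def[symmetric] using self_mem_tcoset[of x s n] by blast
qed

text \<open>The alternating sums of the bar differential and of S have a fixed upper index; they are
  identified with the recursive \<open>faces\<close> and \<open>insertions\<close> on lists of the
  matching length, hence on these representatives.\<close>

definition words :: "nat \<Rightarrow> ('a list \<Rightarrow>\<^sub>0 'k::field) set" where
  "words n = {x. \<forall>l\<in>Poly_Mapping.keys x. length l = n}"

lemma words_subspace: "fs.subspace (words n)"
  by (rule fs.subspaceI)
    (auto simp: words_def in_keys_iff dest!: subsetD[OF Poly_Mapping.keys_add])

lemma single_in_words [simp]: "length l = n \<Longrightarrow> Poly_Mapping.single l c \<in> words n"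
  by (auto simp: words_def)

lemma linext_in_words:
  assumes "x \<in> words n" "\<And>l. length l = n \<Longrightarrow> \<psi> l \<in> words m"
  shows "linext fscale \<psi> x \<in> words m"
  unfolding linext_def
  by (intro fs.subspace_sum fs.subspace_scale words_subspace) (use assms in \<open>auto simp: words_def\<close>)

lemma carrier_bar: "carrier (bar s n) = tcoset s (n + 2) ` words (n + 2)"
  by (simp add: bar_def tensor_power_def words_def)

lemma bar_add: "tcoset s (n + 2) x \<oplus>\<^bsub>bar s n\<^esub> tcoset s (n + 2) y = tcoset s (n + 2) (x + y)"
proof -
  have "z \<in> tcoset s (n + 2) (x + y) \<longleftrightarrow> (\<exists>u\<in>tcoset s (n + 2) x. \<exists>v\<in>tcoset s (n + 2) y. z = u + v)" for z
  proof
    assume "z \<in> tcoset s (n + 2) (x + y)"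
    then have "z - y \<in> tcoset s (n + 2) x"
      by (simp add: mem_tcoset_iff algebra_simps)
    then show "\<exists>u\<in>tcoset s (n + 2) x. \<exists>v\<in>tcoset s (n + 2) y. z = u + v"
      by (rule bexI[rotated]) (auto intro!: bexI[of _ y] self_mem_tcoset)
  next
    assume "\<exists>u\<in>tcoset s (n + 2) x. \<exists>v\<in>tcoset s (n + 2) y. z = u + v"
    then show "z \<in> tcoset s (n + 2) (x + y)"
      using fs.subspace_add[OF tensor_rel_subspace]
      by (fastforce simp: mem_tcoset_iff algebra_simps)
  qed
  then have "{u + v |u v. u \<in> tcoset s (n + 2) x \<and> v \<in> tcoset s (n + 2) y} = tcoset s (n + 2) (x + y)"
    by blast
  then show ?thesis
    by (simp add: bar_def)
qed

section \<open>The insertion homotopy on the bar resolution\<close>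

definition cons_tensor :: "'a \<Rightarrow> ('a list \<Rightarrow>\<^sub>0 'k::field) \<Rightarrow> ('a list \<Rightarrow>\<^sub>0 'k)" where
  "cons_tensor a = linext fscale (\<lambda>l. Poly_Mapping.single (a # l) 1)"

definition head_mult :: "'a::{ring,monoid_mult} \<Rightarrow> ('a list \<Rightarrow>\<^sub>0 'k::field) \<Rightarrow> ('a list \<Rightarrow>\<^sub>0 'k)" where
  "head_mult a = linext fscale (\<lambda>l. Poly_Mapping.single ((a * hd l) # tl l) 1)"

definition last_mult :: "'a::{ring,monoid_mult} \<Rightarrow> ('a list \<Rightarrow>\<^sub>0 'k::field) \<Rightarrow> ('a list \<Rightarrow>\<^sub>0 'k)" where
  "last_mult a = linext fscale (\<lambda>l. Poly_Mapping.single (butlast l @ [last l * a]) 1)"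

text \<open>The bar differential by recursion on the first entry. The minus sign in front of the
  tail produces the alternation.\<close>

fun faces :: "'a::{ring,monoid_mult} list \<Rightarrow> ('a list \<Rightarrow>\<^sub>0 'k::field)" where
  "faces (a # b # l) = Poly_Mapping.single ((a * b) # l) 1 - cons_tensor a (faces (b # l))"
| "faces _ = 0"

fun insertions :: "'a \<Rightarrow> 'a list \<Rightarrow> ('a list \<Rightarrow>\<^sub>0 'k::field)" where
  "insertions \<rho> (a # b # l) =
    Poly_Mapping.single (a # \<rho> # b # l) 1 - cons_tensor a (insertions \<rho> (b # l))"
| "insertions _ _ = 0"

text \<open>Splitting off j = 0 leaves \<open>a\<close> in front of the sum for the tail, with all
  signs reversed.\<close>

lemma faces_eq_sum:
  "length l = n + 2 \<Longrightarrow> faces l = (\<Sum>j=0..n.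
    Poly_Mapping.single (take j l @ [l ! j * l ! (j + 1)] @ drop (j + 2) l) ((-1) ^ j))"
proof (induction n arbitrary: l)
  case 0
  then obtain a b where "l = [a, b]"
    by (auto simp: length_Suc_conv numeral_2_eq_2)
  then show ?case by (simp add: cons_tensor_def)
next
  case (Suc n)
  then obtain a b l' where l: "l = a # b # l'"
    by (auto simp: length_Suc_conv)
  with Suc show ?case
    by (simp add: sum.atLeast0_atMost_Suc_shift cons_tensor_def fs.linext_sum sum_negf
        single_uminus del: sum.cl_ivl_Suc)
qed

lemma insertions_eq_sum:
  "length l = n + 2 \<Longrightarrow> insertions \<rho> l = (\<Sum>j=0..n.
    Poly_Mapping.single (take (j + 1) l @ [\<rho>] @ drop (j + 1) l) ((-1) ^ j))"
proof (induction n arbitrary: l)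
  case 0
  then obtain a b where "l = [a, b]"
    by (auto simp: length_Suc_conv numeral_2_eq_2)
  then show ?case by (simp add: cons_tensor_def)
next
  case (Suc n)
  then obtain a b l' where l: "l = a # b # l'"
    by (auto simp: length_Suc_conv)
  with Suc show ?case
    by (simp add: sum.atLeast0_atMost_Suc_shift cons_tensor_def fs.linext_sum sum_negf
        single_uminus del: sum.cl_ivl_Suc)
qed

lemma keys_cons_tensor: "l \<in> Poly_Mapping.keys (cons_tensor a x) \<Longrightarrow> \<exists>t. l = a # t"
  by (auto simp: cons_tensor_def linext_def dest!: subsetD[OF Poly_Mapping.keys_sum]
      split: if_splits)

text \<open>The rules below for \<open>cons_tensor\<close> fail at the empty list, where
  \<open>hd\<close> and \<open>last\<close> are unspecified. This excludes the empty list among the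
  summands to which they are applied.\<close>

lemma faces_nonempty: "l \<in> Poly_Mapping.keys (faces t :: _ \<Rightarrow>\<^sub>0 'k::field) \<Longrightarrow> l \<noteq> []"
  by (cases t rule: faces.cases)
    (auto dest!: subsetD[OF Poly_Mapping.keys_diff] keys_cons_tensor)

lemma insertions_nonempty: "l \<in> Poly_Mapping.keys (insertions \<rho> t :: _ \<Rightarrow>\<^sub>0 'k::field) \<Longrightarrow> l \<noteq> []"
  by (cases "(\<rho>, t)" rule: insertions.cases)
    (auto dest!: subsetD[OF Poly_Mapping.keys_diff] keys_cons_tensor)

lemma linext_faces_cons_tensor:
  assumes "\<And>l. l \<in> Poly_Mapping.keys x \<Longrightarrow> l \<noteq> []"
  shows "linext fscale faces (cons_tensor a x) = head_mult a x - cons_tensor a (linext fscale faces x)"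
proof -
  have "linext fscale faces (cons_tensor a x) =
      linext fscale (\<lambda>l. Poly_Mapping.single ((a * hd l) # tl l) 1 - cons_tensor a (faces l)) x"
    unfolding cons_tensor_def fs.linext_linext
  proof (rule linext_cong)
    fix l assume "l \<in> Poly_Mapping.keys x"
    with assms show "linext fscale faces (Poly_Mapping.single (a # l) 1) =
        Poly_Mapping.single ((a * hd l) # tl l) 1 -
        linext fscale (\<lambda>l. Poly_Mapping.single (a # l) 1) (faces l)"
      by (cases l) (auto simp: cons_tensor_def)
  qed
  then show ?thesis
    by (simp add: head_mult_def cons_tensor_def fs.linext_linext fs.linext_diff_fun)
qed

lemma linext_insertions_cons_tensor:
  assumes "\<And>l. l \<in> Poly_Mapping.keys x \<Longrightarrow> l \<noteq> []"
  shows "linext fscale (insertions \<rho>) (cons_tensor a x) =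
    cons_tensor a (cons_tensor \<rho> x) - cons_tensor a (linext fscale (insertions \<rho>) x)"
proof -
  have "linext fscale (insertions \<rho>) (cons_tensor a x) =
      linext fscale (\<lambda>l. Poly_Mapping.single (a # \<rho> # l) 1 - cons_tensor a (insertions \<rho> l)) x"
    unfolding cons_tensor_def fs.linext_linext
  proof (rule linext_cong)
    fix l assume "l \<in> Poly_Mapping.keys x"
    with assms show "linext fscale (insertions \<rho>) (Poly_Mapping.single (a # l) 1) =
        Poly_Mapping.single (a # \<rho> # l) 1 -
        linext fscale (\<lambda>l. Poly_Mapping.single (a # l) 1) (insertions \<rho> l)"
      by (cases l) (auto simp: cons_tensor_def)
  qed
  then show ?thesis
    by (simp add: cons_tensor_def fs.linext_linext fs.linext_diff_fun)
qed

lemma cons_tensor_diff: "cons_tensor a (x - y) = cons_tensor a x - cons_tensor a y"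
  and cons_tensor_add: "cons_tensor a (x + y) = cons_tensor a x + cons_tensor a y"
  and cons_tensor_single [simp]:
    "cons_tensor a (Poly_Mapping.single l c) = Poly_Mapping.single (a # l) c"
  and cons_tensor_zero [simp]: "cons_tensor a 0 = 0"
  by (simp_all add: cons_tensor_def fs.linext_diff fs.linext_add)

lemma head_mult_diff: "head_mult a (x - y) = head_mult a x - head_mult a y"
  and head_mult_single [simp]:
    "head_mult a (Poly_Mapping.single l c) = Poly_Mapping.single ((a * hd l) # tl l) c"
  and head_mult_zero [simp]: "head_mult a 0 = 0"
  by (simp_all add: head_mult_def fs.linext_diff)

lemma last_mult_diff: "last_mult a (x - y) = last_mult a x - last_mult a y"
  and last_mult_single [simp]:
    "last_mult a (Poly_Mapping.single l c) = Poly_Mapping.single (butlast l @ [last l * a]) c"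
  and last_mult_zero [simp]: "last_mult a 0 = 0"
  by (simp_all add: last_mult_def fs.linext_diff)

lemma head_mult_cons_tensor: "head_mult a (cons_tensor b x) = cons_tensor (a * b) x"
  by (simp add: head_mult_def cons_tensor_def fs.linext_linext)

lemma last_mult_cons_tensor:
  assumes "\<And>l. l \<in> Poly_Mapping.keys x \<Longrightarrow> l \<noteq> []"
  shows "last_mult a (cons_tensor b x) = cons_tensor b (last_mult a x)"
  using assms by (auto simp: last_mult_def cons_tensor_def fs.linext_linext intro!: linext_cong)

text \<open>No \<rho> is ever placed before the first or after the last entry, so outer
  multiplication commutes with insertion; this is what makes S a bimodule map.\<close>

lemma head_mult_insertions:
  "l \<noteq> [] \<Longrightarrow> head_mult a (insertions \<rho> l) = insertions \<rho> ((a * hd l) # tl l)"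
  by (cases "(\<rho>, l)" rule: insertions.cases)
    (simp_all add: head_mult_diff head_mult_cons_tensor)

lemma last_mult_insertions:
  "l \<noteq> [] \<Longrightarrow> last_mult a (insertions \<rho> l :: _ \<Rightarrow>\<^sub>0 'k::field) = insertions \<rho> (butlast l @ [last l * a])"
proof (induction \<rho> l rule: insertions.induct)
  case (1 \<rho> b c l)
  have "last_mult a (insertions \<rho> (b # c # l) :: _ \<Rightarrow>\<^sub>0 'k) =
      Poly_Mapping.single (b # \<rho> # butlast (c # l) @ [last (c # l) * a]) 1 -
      cons_tensor b (insertions \<rho> (butlast (c # l) @ [last (c # l) * a]))"
    using 1 by (auto simp: last_mult_diff last_mult_cons_tensor insertions_nonempty)
  \<comment> \<open>The recursion of \<open>insertions\<close> has to see a second entry, which is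
    \<open>c * a\<close> or \<open>c\<close> according to whether \<open>l\<close> is empty.\<close>
  also have "\<dots> = insertions \<rho> (butlast (b # c # l) @ [last (b # c # l) * a])"
    by (cases l) auto
  finally show ?case .
qed simp_all

text \<open>The centrality of \<open>\<rho>\<close> makes the two ways of absorbing an inserted \<open>\<rho>\<close> into its neighbours
  cancel telescopically, except at the ends.\<close>

lemma faces_insertions:
  assumes \<rho>: "\<And>a. \<rho> * a = a * \<rho>"
  shows "l \<noteq> [] \<Longrightarrow>
    linext fscale faces (insertions \<rho> l :: _ \<Rightarrow>\<^sub>0 'k::field) + linext fscale (insertions \<rho>) (faces l) =
    Poly_Mapping.single ((\<rho> * hd l) # tl l) 1 - Poly_Mapping.single (butlast l @ [last l * \<rho>]) 1"
proof (induction l rule: faces.induct)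
  case (1 a b l)
  let ?t = "b # l"
  let ?I = "insertions \<rho> ?t :: _ \<Rightarrow>\<^sub>0 'k" and ?F = "faces ?t :: _ \<Rightarrow>\<^sub>0 'k"
  have ne: "\<And>l. l \<in> Poly_Mapping.keys ?I \<Longrightarrow> l \<noteq> []" "\<And>l. l \<in> Poly_Mapping.keys ?F \<Longrightarrow> l \<noteq> []"
    by (erule insertions_nonempty, erule faces_nonempty)
  \<comment> \<open>Two pairs cancel here: a | \<rho> | \<open>?F\<close> arises from both
    composites with opposite signs, and \<open>a\<close> times the head of \<open>?I\<close> cancels
    the insertions into ab | l by \<open>head_mult_insertions\<close>.\<close>
  have "linext fscale faces (insertions \<rho> (a # ?t)) + linext fscale (insertions \<rho>) (faces (a # ?t)) =
      Poly_Mapping.single ((a * \<rho>) # ?t) 1 - Poly_Mapping.single (a # (\<rho> * b) # l) 1 +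
      cons_tensor a (linext fscale faces ?I + linext fscale (insertions \<rho>) ?F)"
    by (simp add: fs.linext_diff linext_faces_cons_tensor[OF ne(1)]
        linext_insertions_cons_tensor[OF ne(2)] cons_tensor_diff cons_tensor_add head_mult_insertions)
  \<comment> \<open>The induction hypothesis contributes a | \<rho> b | l, which cancels the second
    summand; centrality turns a \<rho> into \<rho> a.\<close>
  also have "\<dots> = Poly_Mapping.single ((\<rho> * hd (a # ?t)) # tl (a # ?t)) 1 -
      Poly_Mapping.single (butlast (a # ?t) @ [last (a # ?t) * \<rho>]) 1"
    unfolding 1(1)[OF list.simps(3)] by (simp add: cons_tensor_diff \<rho>)
  finally show ?case .
qed (simp_all add: \<rho>)

section \<open>Word operations that descend to tensor powers\<close>

lemma slotwise_linear_context:
  assumes "\<And>us vs. length us + 1 + length vs = n \<Longrightarrow> \<exists>us' vs'. length us' + 1 + length vs' = m \<and>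
    (\<forall>x. F (us @ [x] @ vs) = us' @ [x] @ vs')"
  shows "slotwise_linear s n m F"
proof (rule slotwise_linearI)
  fix us vs :: "'a list"
  assume "length us + 1 + length vs = n"
  from assms[OF this] show "\<exists>us' vs' g. length us' + 1 + length vs' = m \<and>
      (\<forall>x. F (us @ [x] @ vs) = us' @ [g x] @ vs') \<and>
      (\<forall>x y. g (x + y) = g x + g y) \<and> (\<forall>c x. g (s c x) = s c (g x))"
    by (elim exE conjE) (rule exI, rule exI, rule exI[of _ "\<lambda>x. x"], auto)
qed

lemma slotwise_linear_insert:
  fixes s :: "'k::field \<Rightarrow> 'a::{ring,monoid_mult} \<Rightarrow> 'a"
  assumes "k \<le> n"
  shows "slotwise_linear s n (Suc n) (\<lambda>l. take k l @ [r] @ drop k l)"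
proof (rule slotwise_linear_context)
  fix us vs :: "'a list"
  assume n: "length us + 1 + length vs = n"
  show "\<exists>us' vs'. length us' + 1 + length vs' = Suc n \<and>
    (\<forall>x. take k (us @ [x] @ vs) @ [r] @ drop k (us @ [x] @ vs) = us' @ [x] @ vs')"
  proof (cases "k \<le> length us")
    case True
    then show ?thesis
      using n by (intro exI[of _ "take k us @ [r] @ drop k us"] exI[of _ vs]) auto
  next
    case False
    \<comment> \<open>The \<open>Suc\<close> accounts for the varying entry itself, so the insertion
      point lies j places into \<open>vs\<close>.\<close>
    then obtain j where "k = length us + Suc j"
      by (metis add_Suc_right less_iff_Suc_add not_le)
    then show ?thesis
      using n assms by (intro exI[of _ us] exI[of _ "take j vs @ [r] @ drop j vs"]) auto
  qed
qed

lemma slotwise_linear_wrap: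
  fixes s :: "'k::field \<Rightarrow> 'a::{ring,monoid_mult} \<Rightarrow> 'a"
  shows "slotwise_linear s n (n + 2) (\<lambda>l. [a] @ l @ [b])"
proof (rule slotwise_linear_context)
  fix us vs :: "'a list"
  assume n: "length us + 1 + length vs = n"
  then show "\<exists>us' vs'. length us' + 1 + length vs' = n + 2 \<and>
    (\<forall>x. [a] @ (us @ [x] @ vs) @ [b] = us' @ [x] @ vs')"
    by (intro exI[of _ "a # us"] exI[of _ "vs @ [b]"]) auto
qed

context assoc_algebra
begin

lemma slotwise_linear_head: "slotwise_linear s n n (\<lambda>l. (a * hd l) # tl l)"
proof (rule slotwise_linearI)
  fix us vs :: "'a list"
  assume n: "length us + 1 + length vs = n"
  show "\<exists>us' vs' g. length us' + 1 + length vs' = n \<and>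
    (\<forall>x. (a * hd (us @ [x] @ vs)) # tl (us @ [x] @ vs) = us' @ [g x] @ vs') \<and>
    (\<forall>x y. g (x + y) = g x + g y) \<and> (\<forall>c x. g (s c x) = s c (g x))"
  proof (cases us)
    case Nil
    then show ?thesis
      using n by (intro exI[of _ "[]"] exI[of _ vs] exI[of _ "\<lambda>x. a * x"])
        (auto simp: scale_mult_right distrib_left)
  next
    case (Cons u us')
    then show ?thesis
      using n by (intro exI[of _ "(a * u) # us'"] exI[of _ vs] exI[of _ "\<lambda>x. x"]) auto
  qed
qed

lemma slotwise_linear_last: "slotwise_linear s n n (\<lambda>l. butlast l @ [last l * a])"
proof (rule slotwise_linearI)
  fix us vs :: "'a list"
  assume n: "length us + 1 + length vs = n"
  show "\<exists>us' vs' g. length us' + 1 + length vs' = n \<and>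
    (\<forall>x. butlast (us @ [x] @ vs) @ [last (us @ [x] @ vs) * a] = us' @ [g x] @ vs') \<and>
    (\<forall>x y. g (x + y) = g x + g y) \<and> (\<forall>c x. g (s c x) = s c (g x))"
  proof (cases vs rule: rev_cases)
    case Nil
    then show ?thesis
      using n by (intro exI[of _ us] exI[of _ "[]"] exI[of _ "\<lambda>x. x * a"])
        (auto simp: scale_mult_left distrib_right butlast_append)
  next
    case (snoc vs' v)
    then show ?thesis
      using n by (intro exI[of _ us] exI[of _ "vs' @ [v * a]"] exI[of _ "\<lambda>x. x"])
        (auto simp: butlast_append)
  qed
qed

lemma slotwise_linear_face:
  assumes "j + 1 < n"
  shows "slotwise_linear s n (n - 1) (\<lambda>l. take j l @ [l ! j * l ! (j + 1)] @ drop (j + 2) l)"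
proof (rule slotwise_linearI)
  fix us vs :: "'a list"
  assume n: "length us + 1 + length vs = n"
  let ?F = "\<lambda>l. take j l @ [l ! j * l ! (j + 1)] @ drop (j + 2) l"
  \<comment> \<open>The multiplied pair lies left of the varying entry, has it as right factor, has
    it as left factor, or lies right of it. Only the two middle cases change the entry, by
    multiplication with its neighbour.\<close>
  consider "j + 1 < length us" | "j + 1 = length us" | "j = length us" | "j > length us"
    by linarith
  then show "\<exists>us' vs' g. length us' + 1 + length vs' = n - 1 \<and>
    (\<forall>x. ?F (us @ [x] @ vs) = us' @ [g x] @ vs') \<and>
    (\<forall>x y. g (x + y) = g x + g y) \<and> (\<forall>c x. g (s c x) = s c (g x))"
  proof cases
    case 1
    then show ?thesis
      using n by (intro exI[of _ "?F us"] exI[of _ vs] exI[of _ "\<lambda>x. x"]) (auto simp: nth_append)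
  next
    case 2
    then obtain us' u where "us = us' @ [u]"
      by (metis append_butlast_last_id list.size(3) add_is_0 one_neq_zero)
    then show ?thesis
      using n 2 by (intro exI[of _ us'] exI[of _ vs] exI[of _ "\<lambda>x. u * x"])
        (auto simp: nth_append scale_mult_right distrib_left)
  next
    case 3
    then obtain v vs' where "vs = v # vs'"
      using n assms by (cases vs) auto
    then show ?thesis
      using n 3 by (intro exI[of _ us] exI[of _ vs'] exI[of _ "\<lambda>x. x * v"])
        (auto simp: nth_append scale_mult_left distrib_right)
  next
    case 4
    then obtain k where k: "j = length us + Suc k"
      using less_iff_Suc_add by auto
    let ?G = "take k vs @ [vs ! k * vs ! (k + 1)] @ drop (k + 2) vs"
    show ?thesis
      by (rule exI[of _ us], rule exI[of _ ?G], rule exI[of _ "\<lambda>x. x"])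
        (use n k assms in \<open>auto simp: nth_append nth_Cons' eval_nat_numeral\<close>)
  qed
qed

lemma multilinear_tensor_compose:
  "slotwise_linear s n m F \<Longrightarrow>
    multilinear_mod s fscale (tensor_rel s m) n (\<lambda>l. Poly_Mapping.single (F l) 1)"
  by (rule multilinear_mod_compose[OF multilinear_mod_single])

lemma lact_bar:
  "lact (bar s n) a (tcoset s (n + 2) x) = tcoset s (n + 2) (head_mult a x)"
  unfolding head_mult_def
  by (simp add: bar_def)
    (rule tensor_map_tcoset[OF multilinear_tensor_compose[OF slotwise_linear_head]])

lemma ract_bar:
  "ract (bar s n) (tcoset s (n + 2) x) a = tcoset s (n + 2) (last_mult a x)"
  unfolding last_mult_def
  by (simp add: bar_def)
    (rule tensor_map_tcoset[OF multilinear_tensor_compose[OF slotwise_linear_last]])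

lemma multilinear_faces: "multilinear_mod s fscale (tensor_rel s (n + 1)) (n + 2)
    (\<lambda>l. \<Sum>j=0..n. fscale ((-1) ^ j)
      (Poly_Mapping.single (take j l @ [l ! j * l ! (j + 1)] @ drop (j + 2) l) 1))"
proof (rule multilinear_mod_sum[OF fs.vector_space_axioms tensor_rel_subspace multilinear_tensor_compose])
  fix j assume "j \<in> {0..n}"
  then show "slotwise_linear s (n + 2) (n + 1) (\<lambda>l. take j l @ [l ! j * l ! (j + 1)] @ drop (j + 2) l)"
    using slotwise_linear_face[of j "n + 2"] by simp
qed

lemma multilinear_insertions: "multilinear_mod s fscale (tensor_rel s (n + 3)) (n + 2)
    (\<lambda>l. \<Sum>j=0..n. fscale ((-1) ^ j)
      (Poly_Mapping.single (take (j + 1) l @ [\<rho>] @ drop (j + 1) l) 1))"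
proof (rule multilinear_mod_sum[OF fs.vector_space_axioms tensor_rel_subspace multilinear_tensor_compose])
  fix j assume "j \<in> {0..n}"
  then show "slotwise_linear s (n + 2) (n + 3) (\<lambda>l. take (j + 1) l @ [\<rho>] @ drop (j + 1) l)"
    using slotwise_linear_insert[of "j + 1" "n + 2" s \<rho>] by (simp add: eval_nat_numeral)
qed

lemma bar_diff_tcoset:
  assumes "x \<in> words (n + 2)"
  shows "bar_diff s n (tcoset s (n + 2) x) = tcoset s (n + 1) (linext fscale faces x)"
proof -
  have "bar_diff s n (tcoset s (n + 2) x) = tcoset s (n + 1) (linext fscale
      (\<lambda>l. \<Sum>j=0..n. Poly_Mapping.single (take j l @ [l ! j * l ! (j + 1)] @ drop (j + 2) l) ((-1) ^ j)) x)"
    unfolding bar_diff_def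
    by (rule tensor_map_tcoset) (use multilinear_faces[of n] in simp)
  also have "\<dots> = tcoset s (n + 1) (linext fscale faces x)"
    using assms
    by (intro arg_cong[of _ _ "tcoset s (n + 1)"] linext_cong faces_eq_sum[symmetric])
      (auto simp: words_def)
  finally show ?thesis .
qed

end

text \<open>The map S of degree n. A word of B_n has n + 2 entries, hence n + 1 inner gaps; gap j
  comes after j + 1 entries, and the result has n + 3 entries as in B_(n+1).\<close>

definition bar_insertion ::
    "('k::field \<Rightarrow> 'a::{ring,monoid_mult} \<Rightarrow> 'a) \<Rightarrow> 'a \<Rightarrow> nat \<Rightarrow> ('a, 'k) tensor \<Rightarrow> ('a, 'k) tensor" where
  "bar_insertion s \<rho> n = tensor_map s (n + 3)
    (\<lambda>l. \<Sum>j=0..n. Poly_Mapping.single (take (j + 1) l @ [\<rho>] @ drop (j + 1) l) ((-1) ^ j))"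

context assoc_algebra
begin

lemma bar_insertion_tcoset:
  assumes "x \<in> words (n + 2)"
  shows "bar_insertion s \<rho> n (tcoset s (n + 2) x) = tcoset s (n + 3) (linext fscale (insertions \<rho>) x)"
proof -
  have "bar_insertion s \<rho> n (tcoset s (n + 2) x) = tcoset s (n + 3) (linext fscale
      (\<lambda>l. \<Sum>j=0..n. Poly_Mapping.single (take (j + 1) l @ [\<rho>] @ drop (j + 1) l) ((-1) ^ j)) x)"
    unfolding bar_insertion_def
    by (rule tensor_map_tcoset) (use multilinear_insertions[of n] in simp)
  also have "\<dots> = tcoset s (n + 3) (linext fscale (insertions \<rho>) x)"
    using assms
    by (intro arg_cong[of _ _ "tcoset s (n + 3)"] linext_cong insertions_eq_sum[symmetric])
      (auto simp: words_def)
  finally show ?thesis .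
qed

lemma head_mult_in_words: "x \<in> words n \<Longrightarrow> 0 < n \<Longrightarrow> head_mult a x \<in> words n"
  unfolding head_mult_def by (rule linext_in_words) auto

lemma last_mult_in_words: "x \<in> words n \<Longrightarrow> 0 < n \<Longrightarrow> last_mult a x \<in> words n"
  unfolding last_mult_def by (rule linext_in_words) auto

lemma faces_in_words:
  assumes "x \<in> words (n + 2)"
  shows "linext fscale faces x \<in> words (n + 1)"
  using assms
proof (rule linext_in_words)
  show "faces l \<in> words (n + 1)" if "length l = n + 2" for l
    using that unfolding faces_eq_sum[OF that]
    by (intro fs.subspace_sum words_subspace single_in_words) auto
qed

lemma insertions_in_words:
  assumes "x \<in> words (n + 2)"
  shows "linext fscale (insertions \<rho>) x \<in> words (n + 3)"
  using assms
proof (rule linext_in_words)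
  show "insertions \<rho> l \<in> words (n + 3)" if "length l = n + 2" for l
    using that unfolding insertions_eq_sum[OF that]
    by (intro fs.subspace_sum words_subspace single_in_words) auto
qed

lemma bar_insertion_hom: "bar_insertion s \<rho> n \<in> bimod_hom (bar s n) (bar s (Suc n))"
proof (rule bimod_homI)
  fix v assume "v \<in> carrier (bar s n)"
  then obtain x where x: "x \<in> words (n + 2)" "v = tcoset s (n + 2) x"
    by (auto simp: carrier_bar)
  note eq = bar_add[of s "Suc n", simplified] lact_bar[of "Suc n", simplified]
    ract_bar[of "Suc n", simplified]
  have eq3: "n + 3 = Suc n + 2"
    by simp
  have ne: "l \<noteq> []" if "l \<in> Poly_Mapping.keys x" for l
    using that x(1) by (auto simp: words_def)
  show "bar_insertion s \<rho> n v \<in> carrier (bar s (Suc n))"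
    unfolding x(2) bar_insertion_tcoset[OF x(1)] carrier_bar eq3
    using insertions_in_words[OF x(1)] by (intro imageI) (simp add: eval_nat_numeral)
  show "bar_insertion s \<rho> n (v \<oplus>\<^bsub>bar s n\<^esub> w) =
      bar_insertion s \<rho> n v \<oplus>\<^bsub>bar s (Suc n)\<^esub> bar_insertion s \<rho> n w"
    if "w \<in> carrier (bar s n)" for w
  proof -
    from that obtain y where y: "y \<in> words (n + 2)" "w = tcoset s (n + 2) y"
      by (auto simp: carrier_bar)
    show ?thesis
      unfolding x(2) y(2) bar_add bar_insertion_tcoset[OF x(1)] bar_insertion_tcoset[OF y(1)]
        bar_insertion_tcoset[OF fs.subspace_add[OF words_subspace x(1) y(1)]] eq3 fs.linext_add ..
  qed
  show "bar_insertion s \<rho> n (lact (bar s n) a v) = lact (bar s (Suc n)) a (bar_insertion s \<rho> n v)" for a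
  proof -
    have "linext fscale (insertions \<rho>) (head_mult a x) = head_mult a (linext fscale (insertions \<rho>) x)"
      using ne by (auto simp: head_mult_def fs.linext_linext head_mult_insertions[unfolded head_mult_def]
          intro!: linext_cong)
    then show ?thesis
      unfolding x(2) lact_bar bar_insertion_tcoset[OF x(1)] eq3
      by (subst bar_insertion_tcoset) (simp_all add: head_mult_in_words x(1) eq3 del: add_2_eq_Suc')
  qed
  show "bar_insertion s \<rho> n (ract (bar s n) v a) = ract (bar s (Suc n)) (bar_insertion s \<rho> n v) a" for a
  proof -
    have "linext fscale (insertions \<rho>) (last_mult a x) = last_mult a (linext fscale (insertions \<rho>) x)"
      using ne by (auto simp: last_mult_def fs.linext_linext last_mult_insertions[unfolded last_mult_def]
          intro!: linext_cong)
    then show ?thesis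
      unfolding x(2) ract_bar bar_insertion_tcoset[OF x(1)] eq3
      by (subst bar_insertion_tcoset) (simp_all add: last_mult_in_words x(1) eq3 del: add_2_eq_Suc')
  qed
qed

lemma bar_diff_closed: "X \<in> carrier (bar s (Suc n)) \<Longrightarrow> bar_diff s (Suc n) X \<in> carrier (bar s n)"
  using bar_diff_tcoset[of _ "Suc n"] faces_in_words[of _ "Suc n"] by (auto simp: carrier_bar)

lemma ract_bar_closed: "X \<in> carrier (bar s n) \<Longrightarrow> ract (bar s n) X a \<in> carrier (bar s n)"
  unfolding carrier_bar by (auto simp: ract_bar[simplified] intro!: imageI last_mult_in_words)

lemma bar_add_closed:
  assumes "X \<in> carrier (bar s n)" "Y \<in> carrier (bar s n)"
  shows "X \<oplus>\<^bsub>bar s n\<^esub> Y \<in> carrier (bar s n)"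
  using assms bar_add[of s n] fs.subspace_add[OF words_subspace] by (fastforce simp: carrier_bar)

lemma linext_faces_insertions:
  assumes "\<And>a. \<rho> * a = a * \<rho>" "x \<in> words n" "0 < n"
  shows "linext fscale faces (linext fscale (insertions \<rho>) x) +
    linext fscale (insertions \<rho>) (linext fscale faces x) + last_mult \<rho> x = head_mult \<rho> x"
proof -
  have "linext fscale (\<lambda>l. linext fscale faces (insertions \<rho> l)) x =
    linext fscale (\<lambda>l. Poly_Mapping.single ((\<rho> * hd l) # tl l) 1 -
      Poly_Mapping.single (butlast l @ [last l * \<rho>]) 1 - linext fscale (insertions \<rho>) (faces l)) x"
    by (intro linext_cong)
      (use faces_insertions[OF assms(1)] assms(2,3) in \<open>force simp: words_def algebra_simps\<close>)
  then show ?thesis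
    by (simp add: fs.linext_linext fs.linext_diff_fun head_mult_def last_mult_def)
qed

text \<open>Written as a sum, so that only the addition of the bar bimodule enters; the subtraction
  in \<open>eta\<close> is made after \<open>p\<close> has led into the abelian group
  \<open>P 0\<close>.\<close>

lemma bar_insertion_homotopy_0:
  assumes \<rho>: "\<And>a. \<rho> * a = a * \<rho>" and X: "X \<in> carrier (bar s 0)"
  shows "lact (bar s 0) \<rho> X =
    bar_diff s 1 (bar_insertion s \<rho> 0 X) \<oplus>\<^bsub>bar s 0\<^esub> ract (bar s 0) X \<rho>"
proof -
  from X obtain x where x: "x \<in> words 2" "X = tcoset s 2 x"
    by (auto simp: carrier_bar numeral_2_eq_2)
  \<comment> \<open>A face of a word with two entries has a single entry and so no gap for \<rho>: S
    d contributes nothing in degree 0.\<close>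
  have "linext fscale (insertions \<rho>) (linext fscale faces x) = 0"
    unfolding fs.linext_linext
  proof -
    have "linext fscale (insertions \<rho>) (faces l :: _ \<Rightarrow>\<^sub>0 'k) = 0" if "l \<in> Poly_Mapping.keys x" for l
      using that x(1) by (cases l rule: faces.cases) (auto simp: words_def)
    then show "linext fscale (\<lambda>l. linext fscale (insertions \<rho>) (faces l)) x = 0"
      by (simp add: linext_def[of _ _ x])
  qed
  then have "linext fscale faces (linext fscale (insertions \<rho>) x) + last_mult \<rho> x = head_mult \<rho> x"
    using linext_faces_insertions[OF \<rho> x(1)] by simp
  then show ?thesis
    using x insertions_in_words[of x 0 \<rho>] bar_diff_tcoset[of _ 1] bar_insertion_tcoset[of x 0]
      lact_bar[of 0 \<rho> x] ract_bar[of 0 x \<rho>] bar_add[of s 0]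
    by (simp add: numeral_2_eq_2 numeral_3_eq_3)
qed

lemma bar_insertion_homotopy_Suc:
  assumes \<rho>: "\<And>a. \<rho> * a = a * \<rho>" and X: "X \<in> carrier (bar s (Suc n))"
  shows "lact (bar s (Suc n)) \<rho> X =
    bar_diff s (Suc (Suc n)) (bar_insertion s \<rho> (Suc n) X) \<oplus>\<^bsub>bar s (Suc n)\<^esub>
    bar_insertion s \<rho> n (bar_diff s (Suc n) X) \<oplus>\<^bsub>bar s (Suc n)\<^esub> ract (bar s (Suc n)) X \<rho>"
proof -
  from X obtain x where x: "x \<in> words (n + 3)" "X = tcoset s (n + 3) x"
    by (auto simp: carrier_bar numeral_3_eq_3)
  have *: "linext fscale faces (linext fscale (insertions \<rho>) x) +
    linext fscale (insertions \<rho>) (linext fscale faces x) + last_mult \<rho> x = head_mult \<rho> x"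
    using linext_faces_insertions[OF \<rho> x(1)] by simp
  show ?thesis
    using x insertions_in_words[of x "Suc n" \<rho>] bar_diff_tcoset[of _ "Suc (Suc n)"]
      bar_insertion_tcoset[of x "Suc n"] bar_diff_tcoset[of x "Suc n"]
      faces_in_words[of x "Suc n"] bar_insertion_tcoset[of _ n]
      lact_bar[of "Suc n" \<rho> x] ract_bar[of "Suc n" x \<rho>] bar_add[of s "Suc n"]
    by (simp add: eval_nat_numeral flip: *)
qed

end

section \<open>The bracket with a degree zero cochain\<close>

context assoc_algebra
begin

text \<open>Bimodule maps are only assumed additive and compatible with the two actions. Their
  linearity over the field is recovered by letting a scalar act as left multiplication by
  \<open>s c 1\<close>.\<close>

lemma head_mult_scale_one:
  assumes "x \<in> words n" "0 < n"
  shows "tcoset s n (head_mult (s c 1) x) = tcoset s n (fscale c x)"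
proof -
  have "fscale c x = fscale c (linext fscale (\<lambda>l. Poly_Mapping.single l 1) x)"
    by simp
  also have "\<dots> = linext fscale (\<lambda>l. Poly_Mapping.single l c) x"
    by (simp add: linext_def fs.scale_sum_right mult.commute del: linext_fscale_single)
  finally have "head_mult (s c 1) x - fscale c x =
      linext fscale (\<lambda>l. Poly_Mapping.single ((s c 1 * hd l) # tl l) 1
      - Poly_Mapping.single l c) x"
    by (simp add: head_mult_def fs.linext_diff_fun)
  also have "\<dots> \<in> tensor_rel s n"
    unfolding linext_def
  proof (intro fs.subspace_sum[OF tensor_rel_subspace] fs.subspace_scale[OF tensor_rel_subspace])
    fix l assume "l \<in> Poly_Mapping.keys x"
    then obtain a t where l: "l = a # t" "length t + 1 = n"
      using assms by (cases l) (auto simp: words_def)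
    show "Poly_Mapping.single ((s c 1 * hd l) # tl l) 1 - Poly_Mapping.single l c \<in> tensor_rel s n"
      unfolding tensor_rel_def
      by (rule fs.span_base, rule UnI2, rule CollectI,
          rule exI[of _ "[]"], rule exI[of _ c], rule exI[of _ a], rule exI[of _ t])
        (use l in \<open>simp add: scale_mult_left\<close>)
  qed
  finally show ?thesis
    by (simp add: tcoset_eq_iff)
qed

lemma hom_bar_tcoset:
  assumes f: "f \<in> bimod_hom (bar s n) regular_bimodule" and x: "x \<in> words (n + 2)"
  shows "f (tcoset s (n + 2) x) = linext s (\<lambda>l. f (pure_tensor s l)) x"
proof -
  let ?N = "n + 2"
  have add: "f (tcoset s ?N (u + v)) = f (tcoset s ?N u) + f (tcoset s ?N v)"
    if "u \<in> words ?N" "v \<in> words ?N" for u v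
    using bimod_homD(2)[OF f, of "tcoset s ?N u" "tcoset s ?N v"] that
    unfolding bar_add carrier_bar by simp
  have scale: "f (tcoset s ?N (fscale c u)) = s c (f (tcoset s ?N u))" if "u \<in> words ?N" for c u
    using bimod_homD(3)[OF f, of "tcoset s ?N u" "s c 1"] that
    unfolding lact_bar carrier_bar head_mult_scale_one[OF that, simplified]
    by (simp add: head_mult_scale_one[OF that, simplified] scale_mult_left)
  have zero: "f (tcoset s ?N 0) = 0"
    using scale[of 0 0] fs.subspace_0[OF words_subspace, of ?N] by simp
  \<comment> \<open>The induction is over arbitrary finite sets and coefficients, because the
    partial sums of \<open>x\<close> have other keys than \<open>x\<close>.\<close>
  have "f (tcoset s ?N (\<Sum>l\<in>K. fscale (c l) (Poly_Mapping.single l 1))) =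
      (\<Sum>l\<in>K. s (c l) (f (pure_tensor s l)))"
    if "finite K" "\<forall>l\<in>K. length l = ?N" for K c
    using that
  proof (induction K)
    case (insert l K)
    have "(\<Sum>l\<in>K. fscale (c l) (Poly_Mapping.single l 1)) \<in> words ?N"
      by (intro fs.subspace_sum fs.subspace_scale words_subspace) (use insert in auto)
    moreover have "Poly_Mapping.single l 1 \<in> words ?N"
      using insert by simp
    ultimately show ?case
      using insert by (simp add: add scale words_subspace fs.subspace_scale pure_tensor_def
          del: fscale_single add_2_eq_Suc')
  qed (simp add: zero del: add_2_eq_Suc')
  from this[of "Poly_Mapping.keys x" "Poly_Mapping.lookup x"] x show ?thesis
    unfolding sum_single_eq by (simp add: linext_def words_def)
qed

text \<open>The linear extension of the values on pure tensors is \<open>f\<close> on cosets, so it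
  kills every relation, in particular the generators that express multilinearity.\<close>

lemma multilinear_hom_bar:
  assumes f: "f \<in> bimod_hom (bar s n) regular_bimodule"
  shows "multilinear_mod s s {0} (n + 2) (\<lambda>l. f (pure_tensor s l))"
proof -
  let ?N = "n + 2" and ?L = "linext s (\<lambda>l. f (pure_tensor s l))"
  have *: "?L x = 0" if "x \<in> words ?N" "x \<in> tensor_rel s ?N" for x
  proof -
    have "tcoset s ?N x = tcoset s ?N 0"
      using that by (simp add: tcoset_eq_iff)
    then show ?thesis
      using hom_bar_tcoset[OF f that(1)] hom_bar_tcoset[OF f fs.subspace_0[OF words_subspace]] by simp
  qed
  let ?S = "\<lambda>l. Poly_Mapping.single l (1::'k)"
  show ?thesis
    unfolding multilinear_mod_def
  proof (intro allI impI conjI)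
    fix us vs :: "'a list" and a b c
    assume n: "length us + 1 + length vs = ?N"
    have "?S (us @ [a + b] @ vs) - ?S (us @ [a] @ vs) - ?S (us @ [b] @ vs) \<in> words ?N"
      by (intro fs.subspace_diff words_subspace) (use n in auto)
    then have "?L (?S (us @ [a + b] @ vs) - ?S (us @ [a] @ vs) - ?S (us @ [b] @ vs)) = 0"
      using multilinear_mod_single[of s ?N] n unfolding multilinear_mod_def by (blast intro: *)
    then show "f (pure_tensor s (us @ [a + b] @ vs)) - f (pure_tensor s (us @ [a] @ vs)) -
        f (pure_tensor s (us @ [b] @ vs)) \<in> {0}"
      by (simp add: linext_diff)
    have "?S (us @ [s c a] @ vs) - fscale c (?S (us @ [a] @ vs)) \<in> words ?N"
      by (intro fs.subspace_diff fs.subspace_scale words_subspace) (use n in auto)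
    then have "?L (?S (us @ [s c a] @ vs) - fscale c (?S (us @ [a] @ vs))) = 0"
      using multilinear_mod_single[of s ?N] n unfolding multilinear_mod_def by (blast intro: *)
    then show "f (pure_tensor s (us @ [s c a] @ vs)) - s c (f (pure_tensor s (us @ [a] @ vs))) \<in> {0}"
      by (simp add: linext_diff)
  qed
qed

text \<open>The identity behind G (F f) = f: the outer entries arise from the two actions on 1 | l |
  1.\<close>

lemma hom_bar_mult:
  assumes f: "f \<in> bimod_hom (bar s n) regular_bimodule" and l: "length l = n"
  shows "a * f (pure_tensor s ([1] @ l @ [1])) * b = f (pure_tensor s ([a] @ l @ [b]))"
proof -
  have p: "pure_tensor s ([x] @ l @ [y]) = tcoset s (n + 2) (Poly_Mapping.single ([x] @ l @ [y]) 1)" for x y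
    using l by (simp add: pure_tensor_def)
  have c: "pure_tensor s ([x] @ l @ [y]) \<in> carrier (bar s n)" for x y
    unfolding p carrier_bar by (rule imageI) (use l in simp)
  have L: "lact (bar s n) a (pure_tensor s ([1] @ l @ [1])) = pure_tensor s ([a] @ l @ [1])"
    unfolding p lact_bar by simp
  have R: "ract (bar s n) (pure_tensor s ([a] @ l @ [1])) b = pure_tensor s ([a] @ l @ [b])"
    unfolding p ract_bar by simp
  show ?thesis
    using bimod_homD(3)[OF f c, of a 1 1] bimod_homD(4)[OF f c, of a 1 b] unfolding L R by simp
qed

lemma bar_F_pure:
  assumes f: "f \<in> bimod_hom (bar s (length l)) regular_bimodule"
  shows "bar_F s f (pure_tensor s l) = f (pure_tensor s ([1] @ l @ [1]))"
  unfolding bar_F_def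
  by (rule tensor_lift_pure[OF vector_space_axioms])
    (rule multilinear_mod_compose[OF multilinear_hom_bar[OF f] slotwise_linear_wrap])

text \<open>Covers the compositions whose first argument has degree 0, where the defining sum is
  empty.\<close>

lemma tensor_lift_zero: "tensor_lift s (\<lambda>l. 0) (tcoset s n x) = 0"
  by (subst tensor_lift_tcoset[OF vector_space_axioms])
    (simp_all add: multilinear_mod_def linext_def)

text \<open>Composing in the order g, f gives an empty sum. In the other order the element g(1) =
  \<rho> is inserted at each of the places before, between and after the entries of
  \<open>l\<close>.\<close>

lemma gerst_bracket_zero_pure:
  assumes f: "f \<in> bimod_hom (bar s (Suc (length l))) regular_bimodule"
    and g: "g \<in> bimod_hom (bar s 0) regular_bimodule" "g (pure_tensor s [1, 1]) = \<rho>"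
  shows "gerst_bracket s (Suc (length l)) (bar_F s f) 0 (bar_F s g) (pure_tensor s l) =
    (\<Sum>j=0..length l. s ((-1) ^ j) (f (pure_tensor s ([1] @ (take j l @ [\<rho>] @ drop j l) @ [1]))))"
proof -
  let ?n = "length l"
  let ?\<psi> = "\<lambda>l. \<Sum>i=1..Suc ?n. s ((-1) powi ((int 0 - 1) * (int i - 1)))
       (bar_F s f (pure_tensor s
         (take (i - 1) l @ [bar_F s g (pure_tensor s (take 0 (drop (i - 1) l)))] @ drop (i - 1 + 0) l)))"
  let ?\<chi> = "\<lambda>l. \<Sum>j=0..?n. s ((-1) ^ j) (f (pure_tensor s ([1] @ (take j l @ [\<rho>] @ drop j l) @ [1])))"
  have F: "bar_F s f (pure_tensor s t) = f (pure_tensor s ([1] @ t @ [1]))" if "length t = Suc ?n" for t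
    using bar_F_pure[of f t] f that by simp
  have G: "bar_F s g (pure_tensor s []) = \<rho>"
    using bar_F_pure[of g "[]"] g by simp
  \<comment> \<open>At degree 0 of \<open>g\<close> the exponent is -(i - 1), an integer power that
    agrees with the natural one because -1 is its own inverse.\<close>
  have sgn: "(-1 :: 'k) powi (- int j) = (-1) ^ j" for j
    by (cases "even j") (simp_all add: power_int_minus)
  \<comment> \<open>\<open>bar_F_pure\<close> evaluates \<open>f\<close> at words of the right
    length, so the two functions are compared on lists of length \<open>?n\<close>, which is all
    that \<open>multilinear_mod_cong\<close> looks at.\<close>
  have eq: "?\<psi> t = ?\<chi> t" if "length t = ?n" for t
  proof -
    have "?\<psi> t = (\<Sum>j=0..?n. s ((-1) powi ((int 0 - 1) * (int (Suc j) - 1)))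
       (bar_F s f (pure_tensor s
         (take j t @ [bar_F s g (pure_tensor s (take 0 (drop j t)))] @ drop j t))))"
      unfolding One_nat_def by (subst sum.shift_bounds_cl_Suc_ivl) simp
    also have "\<dots> = ?\<chi> t"
      using that by (intro sum.cong refl) (simp add: F G sgn)
    finally show ?thesis .
  qed
  have "multilinear_mod s s {0} ?n ?\<chi>"
  proof (rule multilinear_mod_sum[OF vector_space_axioms])
    fix j assume "j \<in> {0..?n}"
    then show "multilinear_mod s s {0} ?n
        (\<lambda>l. f (pure_tensor s ([1] @ (take j l @ [\<rho>] @ drop j l) @ [1])))"
      by (intro multilinear_mod_compose[OF multilinear_mod_compose[OF multilinear_hom_bar[OF f]
            slotwise_linear_wrap] slotwise_linear_insert]) simp
  qed simp
  then have "multilinear_mod s s {0} ?n ?\<psi>"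
    by (subst multilinear_mod_cong[OF eq])
  then have "gerst_circ s (Suc ?n) (bar_F s f) 0 (bar_F s g) (pure_tensor s l) = ?\<psi> l"
    unfolding gerst_circ_def by (rule tensor_lift_pure[OF vector_space_axioms])
  moreover have "gerst_circ s 0 (bar_F s g) (Suc ?n) (bar_F s f) (pure_tensor s l) = 0"
    by (simp add: gerst_circ_def tensor_lift_zero pure_tensor_def)
  ultimately show ?thesis
    unfolding gerst_bracket_def using eq[of l] by simp
qed

text \<open>G restores the outer entries, and \<open>hom_bar_mult\<close> absorbs them into the
  argument of \<open>f\<close>. Position j in the inner word becomes the gap after j + 1 entries of
  the whole word, so the alternating sum of S appears.\<close>

lemma bar_bracket_degree_zero:
  assumes f: "f \<in> bimod_hom (bar s (Suc n)) regular_bimodule"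
    and g: "g \<in> bimod_hom (bar s 0) regular_bimodule" "g (pure_tensor s [1, 1]) = \<rho>"
    and X: "X \<in> carrier (bar s n)"
  shows "bar_bracket s (Suc n) f 0 g X = f (bar_insertion s \<rho> n X)"
proof -
  from X obtain x where x: "x \<in> words (n + 2)" "X = tcoset s (n + 2) x"
    by (auto simp: carrier_bar)
  let ?\<psi> = "\<lambda>l. hd l * gerst_bracket s (Suc n) (bar_F s f) 0 (bar_F s g)
    (pure_tensor s (butlast (tl l))) * last l"
  let ?\<chi> = "\<lambda>l. \<Sum>j=0..n. s ((-1) ^ j) (f (pure_tensor s (take (j + 1) l @ [\<rho>] @ drop (j + 1) l)))"
  have eq: "?\<psi> l = ?\<chi> l" if len: "length l = n + 2" for l
  proof -
    obtain a t' where t': "l = a # t'" "length t' = Suc n"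
      using len by (cases l) auto
    then obtain t b where "t' = t @ [b]"
      by (cases t' rule: rev_cases) auto
    with t' have l: "l = [a] @ t @ [b]" "length t = n"
      by simp_all
    have "?\<psi> l = (\<Sum>j=0..n. s ((-1) ^ j)
        (a * f (pure_tensor s ([1] @ (take j t @ [\<rho>] @ drop j t) @ [1])) * b))"
      using gerst_bracket_zero_pure[of f t g \<rho>] f g l
      by (simp add: sum_distrib_left sum_distrib_right scale_mult_left scale_mult_right)
    also have "\<dots> = ?\<chi> l"
      by (intro sum.cong refl, subst hom_bar_mult[OF f]) (use l in auto)
    finally show ?thesis .
  qed
  have "multilinear_mod s s {0} (n + 2) ?\<chi>"
  proof (rule multilinear_mod_sum[OF vector_space_axioms])
    fix j assume "j \<in> {0..n}"
    then show "multilinear_mod s s {0} (n + 2)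
        (\<lambda>l. f (pure_tensor s (take (j + 1) l @ [\<rho>] @ drop (j + 1) l)))"
      using multilinear_hom_bar[OF f]
      by (intro multilinear_mod_compose[OF _ slotwise_linear_insert]) auto
  qed simp
  then have "multilinear_mod s s {0} (n + 2) ?\<psi>"
    by (subst multilinear_mod_cong[OF eq])
  then have "bar_bracket s (Suc n) f 0 g X = linext s ?\<psi> x"
    unfolding bar_bracket_def bar_G_def x(2) by (rule tensor_lift_tcoset[OF vector_space_axioms])
  also have "\<dots> = linext s (\<lambda>l. linext s (\<lambda>l. f (pure_tensor s l)) (insertions \<rho> l)) x"
  proof (rule linext_cong)
    fix l assume "l \<in> Poly_Mapping.keys x"
    then have l: "length l = n + 2"
      using x(1) by (auto simp: words_def)
    show "?\<psi> l = linext s (\<lambda>l. f (pure_tensor s l)) (insertions \<rho> l)"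
      unfolding eq[OF l] insertions_eq_sum[OF l] by (simp add: linext_sum)
  qed
  also have "\<dots> = f (bar_insertion s \<rho> n X)"
    using hom_bar_tcoset[OF f, of "linext fscale (insertions \<rho>) x"] insertions_in_words[OF x(1)]
    unfolding x(2) bar_insertion_tcoset[OF x(1)] by (simp add: linext_linext eval_nat_numeral)
  finally show ?thesis .
qed

text \<open>Both compositions are empty sums; this serves the bracket of two elements of degree 0,
  which lives in degree -1.\<close>

lemma bar_bracket_zero_zero:
  assumes "X \<in> carrier (bar s n)"
  shows "bar_bracket s 0 f 0 g X = 0"
proof -
  have 0: "gerst_bracket s 0 F 0 G (pure_tensor s t) = 0" for F G t
    by (simp add: gerst_bracket_def gerst_circ_def tensor_lift_zero pure_tensor_def)
  show ?thesis
    using assms tensor_lift_zero by (auto simp: bar_bracket_def bar_G_def carrier_bar 0)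
qed

lemma bar_aug_tcoset: "bar_aug s (tcoset s 2 x) = linext s (\<lambda>l. l ! 0 * l ! 1) x"
  unfolding bar_aug_def
proof (rule tensor_lift_tcoset[OF vector_space_axioms])
  show "multilinear_mod s s {0} 2 (\<lambda>l. l ! 0 * l ! 1)"
    unfolding multilinear_mod_def
  proof (intro allI impI)
    fix us vs :: "'a list" assume "length us + 1 + length vs = 2"
    then consider v where "us = []" "vs = [v]" | u where "us = [u]" "vs = []"
      by (cases us; cases vs; auto)
    then show "(\<forall>a b. (us @ [a + b] @ vs) ! 0 * (us @ [a + b] @ vs) ! 1 -
        (us @ [a] @ vs) ! 0 * (us @ [a] @ vs) ! 1 - (us @ [b] @ vs) ! 0 * (us @ [b] @ vs) ! 1 \<in> {0}) \<and>
      (\<forall>c a. (us @ [s c a] @ vs) ! 0 * (us @ [s c a] @ vs) ! 1 -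
        s c ((us @ [a] @ vs) ! 0 * (us @ [a] @ vs) ! 1) \<in> {0})"
      by cases (simp_all add: scale_mult_left scale_mult_right algebra_simps)
  qed
qed

text \<open>Centrality turns \<open>a * \<rho> * b\<close> into \<open>\<rho> * (a * b)\<close>, so a bimodule map on \<open>A \<otimes> A\<close> with value
  \<open>\<rho>\<close> at \<open>1 | 1\<close> factors through the augmentation.\<close>

lemma hom_bar_0_eq:
  assumes f: "f \<in> bimod_hom (bar s 0) regular_bimodule"
    and \<rho>: "f (pure_tensor s [1, 1]) = \<rho>" "\<And>a. \<rho> * a = a * \<rho>" and X: "X \<in> carrier (bar s 0)"
  shows "f X = \<rho> * bar_aug s X"
proof -
  from X obtain x where x: "x \<in> words (0 + 2)" "X = tcoset s (0 + 2) x"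
    by (auto simp: carrier_bar)
  have "f X = linext s (\<lambda>l. f (pure_tensor s l)) x"
    unfolding x(2) by (rule hom_bar_tcoset[OF f x(1)])
  also have "\<dots> = linext s (\<lambda>l. \<rho> * (l ! 0 * l ! 1)) x"
  proof (rule linext_cong)
    fix l assume "l \<in> Poly_Mapping.keys x"
    then obtain a b where l: "l = [a, b]"
      using x(1) by (auto simp: words_def length_Suc_conv numeral_2_eq_2)
    have "f (pure_tensor s l) = a * \<rho> * b"
      using hom_bar_mult[OF f, of "[]" a b] \<rho>(1) by (simp add: l)
    also have "\<dots> = \<rho> * (l ! 0 * l ! 1)"
      unfolding \<rho>(2)[symmetric] by (simp add: l mult.assoc)
    finally show "f (pure_tensor s l) = \<rho> * (l ! 0 * l ! 1)" .
  qed
  also have "\<dots> = \<rho> * linext s (\<lambda>l. l ! 0 * l ! 1) x"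
    by (simp add: linext_def sum_distrib_left scale_mult_right)
  also have "linext s (\<lambda>l. l ! 0 * l ! 1) x = bar_aug s X"
    using bar_aug_tcoset[of x] x(2) by (simp add: numeral_2_eq_2)
  finally show ?thesis .
qed

lemma bar_aug_one: "bar_aug s (pure_tensor s [1, 1]) = 1"
  using bar_aug_tcoset[of "Poly_Mapping.single [1, 1] 1"] by (simp add: pure_tensor_def numeral_2_eq_2)

end

section \<open>Comparison with a projective resolution\<close>

lemma cochains_nat: "cochains P (int n) = bimod_hom (P n) regular_bimodule"
  by (simp add: cochains_def cx_obj_def)

lemma cochains_diff:
  assumes "f \<in> cochains P d" "g \<in> cochains P d"
  shows "(\<lambda>v. f v - g v) \<in> cochains P d"
  using bimod_homD[OF assms(1)[unfolded cochains_def]] bimod_homD[OF assms(2)[unfolded cochains_def]]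
  unfolding cochains_def by (intro bimod_homI) (simp_all add: algebra_simps)

lemma coboundaries_diff:
  assumes "f \<in> coboundaries P \<delta> d" "g \<in> coboundaries P \<delta> d"
  shows "(\<lambda>v. f v - g v) \<in> coboundaries P \<delta> d"
proof -
  from assms obtain f' g' where *: "f' \<in> cochains P (d - 1)" "g' \<in> cochains P (d - 1)"
      "\<And>v. v \<in> carrier (cx_obj P d) \<Longrightarrow> f v = f' (cx_diff P \<delta> d v)"
      "\<And>v. v \<in> carrier (cx_obj P d) \<Longrightarrow> g v = g' (cx_diff P \<delta> d v)"
    unfolding coboundaries_def by blast
  moreover have "(\<lambda>v. f v - g v) \<in> cochains P d"
    using assms by (intro cochains_diff) (auto simp: coboundaries_def)
  ultimately show ?thesis
    unfolding coboundaries_def by (auto intro!: bexI[OF _ cochains_diff[OF *(1,2)]])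
qed

lemma coh_class_eqI:
  assumes "(\<lambda>v. f v - g v) \<in> coboundaries P \<delta> d"
  shows "coh_class P \<delta> d f = coh_class P \<delta> d g"
proof -
  \<comment> \<open>With zero obtained as a difference, negatives become available too: k - g = (k -
    f) - (0 - (f - g)).\<close>
  have 0: "(\<lambda>v. 0) \<in> coboundaries P \<delta> d"
    using coboundaries_diff[OF assms assms] by simp
  have "(\<lambda>v. k v - f v) \<in> coboundaries P \<delta> d \<longleftrightarrow> (\<lambda>v. k v - g v) \<in> coboundaries P \<delta> d" for k
    using coboundaries_diff[of "\<lambda>v. k v - f v" P \<delta> d, OF _ coboundaries_diff[OF 0 assms]]
      coboundaries_diff[of "\<lambda>v. k v - g v" P \<delta> d, OF _ assms]
    by (auto simp: algebra_simps)
  then show ?thesis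
    by (simp add: coh_class_def)
qed

locale bimodule_resolution = assoc_algebra s
  for s :: "'k::field \<Rightarrow> 'a::{ring,monoid_mult} \<Rightarrow> 'a"
    and P :: "nat \<Rightarrow> ('a, 'p) bimodule" and \<delta> :: "nat \<Rightarrow> 'p \<Rightarrow> 'p" and \<mu> :: "'p \<Rightarrow> 'a" +
  assumes resolution: "projective_resolution s P \<delta> \<mu>"
begin

lemma projective: "projective_bimodule s (P n)"
  and \<delta>_hom: "\<delta> (Suc n) \<in> bimod_hom (P (Suc n)) (P n)"
  and \<mu>_hom: "\<mu> \<in> bimod_hom (P 0) regular_bimodule"
  and ker_\<mu>: "\<delta> 1 ` carrier (P 1) = {v \<in> carrier (P 0). \<mu> v = 0}"
  and ker_\<delta>: "\<delta> (Suc (Suc n)) ` carrier (P (Suc (Suc n))) =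
    {v \<in> carrier (P (Suc n)). \<delta> (Suc n) v = \<zero>\<^bsub>P n\<^esub>}"
  using resolution by (simp_all add: projective_resolution_def)

sublocale P: bimodule s "P n" for n
  using projective by (simp add: projective_bimodule_def)

lemmas \<delta>_closed = bimod_homD(1)[OF \<delta>_hom]

lemma \<delta>_\<delta>: "v \<in> carrier (P (Suc (Suc n))) \<Longrightarrow> \<delta> (Suc n) (\<delta> (Suc (Suc n)) v) = \<zero>\<^bsub>P n\<^esub>"
  using ker_\<delta>[of n] by blast

lemma hom_P_zero: "f \<in> bimod_hom (P m) (P n) \<Longrightarrow> f \<zero>\<^bsub>P m\<^esub> = \<zero>\<^bsub>P n\<^esub>"
  by (rule bimod_hom_zero[OF P.abelian_group_axioms P.abelian_group_axioms])

lemma hom_P_minus: "f \<in> bimod_hom (P m) (P n) \<Longrightarrow> v \<in> carrier (P m) \<Longrightarrow> w \<in> carrier (P m) \<Longrightarrow>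
    f (v \<ominus>\<^bsub>P m\<^esub> w) = f v \<ominus>\<^bsub>P n\<^esub> f w"
  by (rule bimod_hom_minus[OF P.abelian_group_axioms P.abelian_group_axioms])

lemma hom_A_zero: "f \<in> bimod_hom (P m) regular_bimodule \<Longrightarrow> f \<zero>\<^bsub>P m\<^esub> = 0"
  using bimod_hom_zero[OF P.abelian_group_axioms abelian_group_regular] by simp

lemma hom_A_minus: "f \<in> bimod_hom (P m) regular_bimodule \<Longrightarrow> v \<in> carrier (P m) \<Longrightarrow> w \<in> carrier (P m) \<Longrightarrow>
    f (v \<ominus>\<^bsub>P m\<^esub> w) = f v - f w"
  using bimod_hom_minus[OF P.abelian_group_axioms abelian_group_regular] by simp

text \<open>Lifting zero means that the image of \<open>f 0\<close> lies in the kernel of \<mu>,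
  that is in the image of \<open>\<delta> 1\<close>, where the recursion starts.\<close>

lemma lifting_zero_null_homotopic:
  assumes "is_lifting P \<delta> \<mu> P \<delta> \<mu> (\<lambda>a. 0) f"
  obtains u where "\<And>n. u n \<in> bimod_hom (P n) (P (Suc n))"
    and "\<And>v. v \<in> carrier (P 0) \<Longrightarrow> f 0 v = \<delta> 1 (u 0 v)"
    and "\<And>n v. v \<in> carrier (P (Suc n)) \<Longrightarrow>
      f (Suc n) v = u n (\<delta> (Suc n) v) \<oplus>\<^bsub>P (Suc n)\<^esub> \<delta> (Suc (Suc n)) (u (Suc n) v)"
proof -
  have f: "\<And>n. f n \<in> bimod_hom (P n) (P n)" "\<forall>v\<in>carrier (P 0). \<mu> (f 0 v) = 0"
    "\<And>n v. v \<in> carrier (P (Suc n)) \<Longrightarrow> \<delta> (Suc n) (f (Suc n) v) = f n (\<delta> (Suc n) v)"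
    using assms by (auto simp: is_lifting_def)
  have f0: "f 0 ` carrier (P 0) \<subseteq> \<delta> 1 ` carrier (P 1)"
    unfolding ker_\<mu> using f(2) bimod_homD(1)[OF f(1)] by auto
  have ex: "v \<in> \<delta> (Suc (Suc n)) ` carrier (P (Suc (Suc n)))"
    if "v \<in> carrier (P (Suc n))" "\<delta> (Suc n) v = \<zero>\<^bsub>P n\<^esub>" for n v
    using that by (simp add: ker_\<delta>)
  show ?thesis
    using chain_map_null_homotopic[OF projective \<delta>_hom \<delta>_\<delta> P.bimodule_axioms \<delta>_hom ex f(1,3) f0] that
    by metis
qed

text \<open>Shifting the resolution by one and negating its differentials turns an anticommuting map of
  degree one into a chain map.\<close>

lemma anti_chain_map_null_homotopic:
  assumes f: "\<And>n. f n \<in> bimod_hom (P n) (P (Suc n))"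
    and f0: "\<And>v. v \<in> carrier (P 0) \<Longrightarrow> \<delta> 1 (f 0 v) = \<zero>\<^bsub>P 0\<^esub>"
    and anti: "\<And>n v. v \<in> carrier (P (Suc n)) \<Longrightarrow>
      \<delta> (Suc (Suc n)) (f (Suc n) v) = \<ominus>\<^bsub>P (Suc n)\<^esub> f n (\<delta> (Suc n) v)"
  obtains u where "\<And>n. u n \<in> bimod_hom (P n) (P (Suc (Suc n)))"
    and "\<And>n v. v \<in> carrier (P (Suc n)) \<Longrightarrow> \<exists>w\<in>carrier (P (Suc (Suc (Suc n)))).
      f (Suc n) v = u n (\<delta> (Suc n) v) \<oplus>\<^bsub>P (Suc (Suc n))\<^esub> \<delta> (Suc (Suc (Suc n))) w"
proof -
  let ?d = "\<lambda>n v. \<ominus>\<^bsub>P n\<^esub> \<delta> (Suc n) v"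
  have d: "?d n \<in> bimod_hom (P (Suc n)) (P n)" for n
    by (rule P.hom_uminus_closed[OF \<delta>_hom])
  have \<delta>_neg: "\<delta> (Suc n) (\<ominus>\<^bsub>P (Suc n)\<^esub> w) = \<ominus>\<^bsub>P n\<^esub> \<delta> (Suc n) w" if "w \<in> carrier (P (Suc n))" for n w
    using hom_P_minus[OF \<delta>_hom, of "\<zero>\<^bsub>P (Suc n)\<^esub>" n w] that \<delta>_closed[OF that]
    by (simp add: P.minus_eq hom_P_zero[OF \<delta>_hom])
  have ex: "v \<in> ?d (Suc n) ` carrier (P (Suc (Suc n)))"
    if v: "v \<in> carrier (P (Suc n))" and "\<delta> (Suc n) v = \<zero>\<^bsub>P n\<^esub>" for n v
  proof -
    from that obtain w where w: "w \<in> carrier (P (Suc (Suc n)))" "v = \<delta> (Suc (Suc n)) w"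
      using ker_\<delta>[of n] by blast
    then show ?thesis
      using v by (intro image_eqI[of _ _ "\<ominus>\<^bsub>P (Suc (Suc n))\<^esub> w"]) (simp_all add: \<delta>_neg)
  qed
  have ex': "v \<in> ?d (Suc (Suc n)) ` carrier (P (Suc (Suc (Suc n))))"
    if v: "v \<in> carrier (P (Suc (Suc n)))" and "?d (Suc n) v = \<zero>\<^bsub>P (Suc n)\<^esub>" for n v
    using that \<delta>_closed[OF v] by (intro ex) (simp_all add: P.add.inv_eq_1_iff)
  \<comment> \<open>In the shifted complex \<open>\<delta> 1\<close> plays the part of the
    augmentation: \<open>f 0\<close> lands in its kernel, which is the image of
    \<open>\<delta> 2\<close>.\<close>
  have f0': "f 0 ` carrier (P 0) \<subseteq> ?d 1 ` carrier (P (Suc 1))"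
    using ex[of _ 0] f0 bimod_homD(1)[OF f] by auto
  have chain: "?d (Suc n) (f (Suc n) v) = f n (\<delta> (Suc n) v)" if "v \<in> carrier (P (Suc n))" for n v
    using that bimod_homD(1)[OF f \<delta>_closed[OF that]] by (simp add: anti)
  obtain u where u: "\<And>n. u n \<in> bimod_hom (P n) (P (Suc (Suc n)))"
    "\<And>n v. v \<in> carrier (P (Suc n)) \<Longrightarrow>
      f (Suc n) v = u n (\<delta> (Suc n) v) \<oplus>\<^bsub>P (Suc (Suc n))\<^esub> ?d (Suc (Suc n)) (u (Suc n) v)"
    by (rule chain_map_null_homotopic[where Q = "\<lambda>n. P (Suc n)" and d = ?d, OF projective \<delta>_hom \<delta>_\<delta>
        P.bimodule_axioms d ex' f chain f0'])
      (assumption+, (rule that; assumption))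
  show ?thesis
  proof (rule that[OF u(1)])
    fix n v assume v: "v \<in> carrier (P (Suc n))"
    have "u (Suc n) v \<in> carrier (P (Suc (Suc (Suc n))))"
      using bimod_homD(1)[OF u(1) v] .
    \<comment> \<open>The sign of the negated differential is moved into the witness: a cocycle
      kills \<delta> w for every w, so later steps ask only for some boundary.\<close>
    then show "\<exists>w\<in>carrier (P (Suc (Suc (Suc n)))).
      f (Suc n) v = u n (\<delta> (Suc n) v) \<oplus>\<^bsub>P (Suc (Suc n))\<^esub> \<delta> (Suc (Suc (Suc n))) w"
      using u(2)[OF v] by (intro bexI[of _ "\<ominus>\<^bsub>P (Suc (Suc (Suc n)))\<^esub> u (Suc n) v"]) (simp_all add: \<delta>_neg)
  qed
qed

end

section \<open>The commutator with a central element and its null-homotopy\<close>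

locale central_bimodule_resolution = bimodule_resolution +
  fixes \<rho> :: 'b
  assumes central: "\<rho> * a = a * \<rho>"
begin

lemma eta_hom: "eta P \<rho> n \<in> bimod_hom (P n) (P n)"
  using P.commutator_hom[OF central] by (simp add: eta_def [abs_def])

lemmas eta_closed = bimod_homD(1)[OF eta_hom]

lemma hom_P_eta:
  assumes "f \<in> bimod_hom (P m) (P n)" "v \<in> carrier (P m)"
  shows "f (eta P \<rho> m v) = eta P \<rho> n (f v)"
  using assms bimod_homD[OF assms(1)]
  by (simp add: eta_def hom_P_minus P.lact_closed P.ract_closed)

lemma hom_A_eta:
  assumes "f \<in> bimod_hom (P m) regular_bimodule" "v \<in> carrier (P m)"
  shows "f (eta P \<rho> m v) = 0"
  using assms bimod_homD[OF assms(1)]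
  by (simp add: eta_def hom_A_minus P.lact_closed P.ract_closed central)

lemma eta_lifting: "is_lifting P \<delta> \<mu> P \<delta> \<mu> (\<lambda>a. 0) (eta P \<rho>)"
  by (simp add: is_lifting_def eta_hom hom_P_eta[OF \<delta>_hom] hom_A_eta[OF \<mu>_hom])

lemma eta_homotopy_exists: "\<exists>h. is_eta_homotopy P \<delta> \<rho> h"
proof -
  obtain h where h: "\<And>n. h n \<in> bimod_hom (P n) (P (Suc n))"
    "\<And>v. v \<in> carrier (P 0) \<Longrightarrow> eta P \<rho> 0 v = \<delta> 1 (h 0 v)"
    "\<And>n v. v \<in> carrier (P (Suc n)) \<Longrightarrow>
      eta P \<rho> (Suc n) v = h n (\<delta> (Suc n) v) \<oplus>\<^bsub>P (Suc n)\<^esub> \<delta> (Suc (Suc n)) (h (Suc n) v)"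
    by (rule lifting_zero_null_homotopic[OF eta_lifting]) (rule that)
  have "is_eta_homotopy P \<delta> \<rho> h"
    unfolding is_eta_homotopy_def
  proof (intro conjI allI impI ballI)
    fix n v assume "1 \<le> n" "v \<in> carrier (P n)"
    then show "eta P \<rho> n v = h (n - 1) (\<delta> n v) \<oplus>\<^bsub>P n\<^esub> \<delta> (n + 1) (h n v)"
      using h(3) by (cases n) auto
  qed (simp_all add: h)
  then show ?thesis by blast
qed

end

text \<open>\<open>j\<close> and \<open>p\<close> are the comparison morphisms that compute the
  bracket. The morphism whose component in degree 0 is composed with l may differ from
  \<open>j\<close> and enters only in the final theorem.\<close>

locale central_comparison = central_bimodule_resolution +
  fixes h :: "nat \<Rightarrow> 'c \<Rightarrow> 'c" and j :: "nat \<Rightarrow> 'c \<Rightarrow> ('b, 'a) tensor"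
    and p :: "nat \<Rightarrow> ('b, 'a) tensor \<Rightarrow> 'c"
  assumes h: "is_eta_homotopy P \<delta> \<rho> h"
    and j: "is_lifting P \<delta> \<mu> (bar s) (bar_diff s) (bar_aug s) (\<lambda>a. a) j"
    and p: "is_lifting (bar s) (bar_diff s) (bar_aug s) P \<delta> \<mu> (\<lambda>a. a) p"
begin

lemma h_hom: "h n \<in> bimod_hom (P n) (P (Suc n))"
  and h_0: "v \<in> carrier (P 0) \<Longrightarrow> \<delta> 1 (h 0 v) = eta P \<rho> 0 v"
  using h by (simp_all add: is_eta_homotopy_def)

lemma h_Suc:
  assumes v: "v \<in> carrier (P (Suc n))"
  shows "\<delta> (Suc (Suc n)) (h (Suc n) v) = eta P \<rho> (Suc n) v \<ominus>\<^bsub>P (Suc n)\<^esub> h n (\<delta> (Suc n) v)"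
proof -
  have "eta P \<rho> (Suc n) v = h n (\<delta> (Suc n) v) \<oplus>\<^bsub>P (Suc n)\<^esub> \<delta> (Suc (Suc n)) (h (Suc n) v)"
    using h v unfolding is_eta_homotopy_def by (metis One_nat_def Suc_eq_plus1 diff_Suc_1 le_add2)
  then show ?thesis
    using v by (intro P.minus_unique[symmetric])
      (simp_all add: eta_closed \<delta>_closed bimod_homD(1)[OF h_hom] P.a_comm)
qed

lemma j_hom: "j n \<in> bimod_hom (P n) (bar s n)"
  and j_Suc: "v \<in> carrier (P (Suc n)) \<Longrightarrow> bar_diff s (Suc n) (j (Suc n) v) = j n (\<delta> (Suc n) v)"
  and j_aug: "v \<in> carrier (P 0) \<Longrightarrow> bar_aug s (j 0 v) = \<mu> v"
  using j by (simp_all add: is_lifting_def)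

lemma p_hom: "p n \<in> bimod_hom (bar s n) (P n)"
  and p_Suc: "X \<in> carrier (bar s (Suc n)) \<Longrightarrow> \<delta> (Suc n) (p (Suc n) X) = p n (bar_diff s (Suc n) X)"
  and p_aug: "X \<in> carrier (bar s 0) \<Longrightarrow> \<mu> (p 0 X) = bar_aug s X"
  using p by (simp_all add: is_lifting_def)

definition round_trip where "round_trip n v = p n (j n v)"

definition pull_homotopy where "pull_homotopy n v = p (Suc n) (bar_insertion s \<rho> n (j n v))"

lemma round_trip_hom: "round_trip n \<in> bimod_hom (P n) (P n)"
  unfolding round_trip_def [abs_def] by (rule bimod_hom_comp[OF p_hom j_hom])

lemma pull_homotopy_hom: "pull_homotopy n \<in> bimod_hom (P n) (P (Suc n))"
  unfolding pull_homotopy_def [abs_def]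
  by (rule bimod_hom_comp[OF p_hom bimod_hom_comp[OF bar_insertion_hom j_hom]])

lemmas j_closed = bimod_homD(1)[OF j_hom]
lemmas p_closed = bimod_homD(1)[OF p_hom]
lemmas h_closed = bimod_homD(1)[OF h_hom]
lemmas pull_homotopy_closed = bimod_homD(1)[OF pull_homotopy_hom]
lemmas round_trip_closed = bimod_homD(1)[OF round_trip_hom]
lemmas bar_insertion_closed = bimod_homD(1)[OF bar_insertion_hom]

lemma round_trip_Suc: "v \<in> carrier (P (Suc n)) \<Longrightarrow>
    \<delta> (Suc n) (round_trip (Suc n) v) = round_trip n (\<delta> (Suc n) v)"
  by (simp add: round_trip_def p_Suc j_closed j_Suc)

text \<open>Apply \<open>p\<close> to the homotopy equation of the bar resolution at
  \<open>j 0 v\<close>: \<open>p\<close> preserves both actions and commutes with the differentials,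
  so the equation becomes one in \<open>P 0\<close>.\<close>

lemma pull_homotopy_0:
  assumes v: "v \<in> carrier (P 0)"
  shows "\<delta> 1 (pull_homotopy 0 v) = eta P \<rho> 0 (round_trip 0 v)"
proof -
  let ?X = "j 0 v"
  have X: "?X \<in> carrier (bar s 0)"
    by (rule j_closed[OF v])
  have "lact (P 0) \<rho> (round_trip 0 v) = p 0 (lact (bar s 0) \<rho> ?X)"
    by (simp add: round_trip_def bimod_homD(3)[OF p_hom] X)
  also have "\<dots> = p 0 (bar_diff s 1 (bar_insertion s \<rho> 0 ?X)) \<oplus>\<^bsub>P 0\<^esub> p 0 (ract (bar s 0) ?X \<rho>)"
    unfolding bar_insertion_homotopy_0[OF central X]
    using bar_diff_closed[OF bar_insertion_closed[OF X]] ract_bar_closed[OF X]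
    by (subst bimod_homD(2)[OF p_hom]) simp_all
  also have "\<dots> = \<delta> 1 (pull_homotopy 0 v) \<oplus>\<^bsub>P 0\<^esub> ract (P 0) (round_trip 0 v) \<rho>"
    using p_Suc[OF bar_insertion_closed[OF X]]
    by (simp add: pull_homotopy_def round_trip_def bimod_homD(4)[OF p_hom X])
  finally show ?thesis
    unfolding eta_def using v \<delta>_closed[OF pull_homotopy_closed[OF v]] round_trip_closed[OF v]
    by (intro P.minus_unique[symmetric]) (simp_all add: P.lact_closed P.ract_closed)
qed

lemma pull_homotopy_Suc:
  assumes v: "v \<in> carrier (P (Suc n))"
  shows "\<delta> (Suc (Suc n)) (pull_homotopy (Suc n) v) =
    eta P \<rho> (Suc n) (round_trip (Suc n) v) \<ominus>\<^bsub>P (Suc n)\<^esub> pull_homotopy n (\<delta> (Suc n) v)"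
proof -
  let ?X = "j (Suc n) v" and ?n = "Suc n"
  have X: "?X \<in> carrier (bar s ?n)"
    by (rule j_closed[OF v])
  have Y: "bar_diff s (Suc ?n) (bar_insertion s \<rho> ?n ?X) \<in> carrier (bar s ?n)"
    "bar_insertion s \<rho> n (bar_diff s ?n ?X) \<in> carrier (bar s ?n)"
    using X by (simp_all add: bar_diff_closed bar_insertion_closed)
  have "lact (P ?n) \<rho> (round_trip ?n v) = p ?n (lact (bar s ?n) \<rho> ?X)"
    by (simp add: round_trip_def bimod_homD(3)[OF p_hom] X)
  also have "\<dots> = p ?n (bar_diff s (Suc ?n) (bar_insertion s \<rho> ?n ?X)) \<oplus>\<^bsub>P ?n\<^esub>
      p ?n (bar_insertion s \<rho> n (bar_diff s ?n ?X)) \<oplus>\<^bsub>P ?n\<^esub> p ?n (ract (bar s ?n) ?X \<rho>)"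
    unfolding bar_insertion_homotopy_Suc[OF central X]
    using Y ract_bar_closed[OF X] by (simp add: bimod_homD(2)[OF p_hom] bar_add_closed)
  also have "\<dots> = \<delta> (Suc ?n) (pull_homotopy ?n v) \<oplus>\<^bsub>P ?n\<^esub> pull_homotopy n (\<delta> ?n v) \<oplus>\<^bsub>P ?n\<^esub>
      ract (P ?n) (round_trip ?n v) \<rho>"
    by (simp add: pull_homotopy_def round_trip_def bimod_homD(4)[OF p_hom X] p_Suc
        bar_insertion_closed X j_Suc v)
  finally have "eta P \<rho> ?n (round_trip ?n v) =
      \<delta> (Suc ?n) (pull_homotopy ?n v) \<oplus>\<^bsub>P ?n\<^esub> pull_homotopy n (\<delta> ?n v)"
    unfolding eta_def using v \<delta>_closed[OF pull_homotopy_closed[OF v]] round_trip_closed[OF v]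
    by (intro P.minus_unique) (simp_all add: P.lact_closed P.ract_closed pull_homotopy_closed \<delta>_closed)
  then show ?thesis
    using v by (intro P.minus_unique[symmetric])
      (simp_all add: eta_closed round_trip_closed pull_homotopy_closed \<delta>_closed)
qed

definition defect where "defect n v = pull_homotopy n v \<ominus>\<^bsub>P (Suc n)\<^esub> round_trip (Suc n) (h n v)"

lemma defect_hom: "defect n \<in> bimod_hom (P n) (P (Suc n))"
  unfolding defect_def [abs_def]
  by (rule P.hom_minus_closed[OF pull_homotopy_hom bimod_hom_comp[OF round_trip_hom h_hom]])

lemma defect_0:
  assumes "v \<in> carrier (P 0)"
  shows "\<delta> 1 (defect 0 v) = \<zero>\<^bsub>P 0\<^esub>"
  using hom_P_minus[OF \<delta>_hom pull_homotopy_closed[OF assms] round_trip_closed[OF h_closed[OF assms]]] assms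
  by (simp add: defect_def pull_homotopy_0[simplified] round_trip_Suc h_closed h_0[simplified]
      hom_P_eta[OF round_trip_hom] eta_closed
      round_trip_closed P.minus_eq P.r_neg)

text \<open>The two homotopies share the term \<open>?e\<close>. It cancels, and what remains is the
  defect one degree lower, negated.\<close>

lemma defect_Suc:
  assumes v: "v \<in> carrier (P (Suc n))"
  shows "\<delta> (Suc (Suc n)) (defect (Suc n) v) = \<ominus>\<^bsub>P (Suc n)\<^esub> defect n (\<delta> (Suc n) v)"
proof -
  let ?n = "Suc n"
  let ?e = "eta P \<rho> ?n (round_trip ?n v)" and ?x = "pull_homotopy n (\<delta> ?n v)"
    and ?y = "round_trip ?n (h n (\<delta> ?n v))"
  have cl: "?e \<in> carrier (P ?n)" "?x \<in> carrier (P ?n)" "?y \<in> carrier (P ?n)"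
    using v by (simp_all add: eta_closed round_trip_closed pull_homotopy_closed h_closed \<delta>_closed)
  have "round_trip ?n (\<delta> (Suc ?n) (h ?n v)) = ?e \<ominus>\<^bsub>P ?n\<^esub> ?y"
    using v by (simp add: h_Suc hom_P_minus[OF round_trip_hom] eta_closed h_closed \<delta>_closed
        hom_P_eta[OF round_trip_hom])
  then have "\<delta> (Suc ?n) (defect ?n v) = (?e \<ominus>\<^bsub>P ?n\<^esub> ?x) \<ominus>\<^bsub>P ?n\<^esub> (?e \<ominus>\<^bsub>P ?n\<^esub> ?y)"
    unfolding defect_def using v
    by (simp add: hom_P_minus[OF \<delta>_hom] pull_homotopy_closed round_trip_closed h_closed
        pull_homotopy_Suc round_trip_Suc)
  also have "\<dots> = \<ominus>\<^bsub>P ?n\<^esub> (?x \<ominus>\<^bsub>P ?n\<^esub> ?y)"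
    by (rule P.minus_minus_cancel_left[OF cl])
  finally show ?thesis
    by (simp add: defect_def)
qed

text \<open>In degree 0, \<mu> p j is the bar augmentation after \<open>j\<close>, hence \<mu>, so p
  j - id lifts zero. The second homotopy term is kept only as some boundary, which a cocycle
  annihilates.\<close>

lemma round_trip_homotopy:
  obtains k where "\<And>n. k n \<in> bimod_hom (P n) (P (Suc n))"
    and "\<And>n v. v \<in> carrier (P (Suc n)) \<Longrightarrow> \<exists>w\<in>carrier (P (Suc (Suc n))).
      round_trip (Suc n) v \<ominus>\<^bsub>P (Suc n)\<^esub> v = k n (\<delta> (Suc n) v) \<oplus>\<^bsub>P (Suc n)\<^esub> \<delta> (Suc (Suc n)) w"
proof -
  have "is_lifting P \<delta> \<mu> P \<delta> \<mu> (\<lambda>a. 0) (\<lambda>n v. round_trip n v \<ominus>\<^bsub>P n\<^esub> v)"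
    unfolding is_lifting_def
    by (simp add: P.hom_minus_closed[OF round_trip_hom bimod_hom_id] hom_P_minus[OF \<delta>_hom]
        hom_A_minus[OF \<mu>_hom]
        round_trip_closed round_trip_Suc \<delta>_closed) (simp add: round_trip_def p_aug j_closed j_aug)
  then obtain k where k: "\<And>n. k n \<in> bimod_hom (P n) (P (Suc n))"
    "\<And>n v. v \<in> carrier (P (Suc n)) \<Longrightarrow>
      round_trip (Suc n) v \<ominus>\<^bsub>P (Suc n)\<^esub> v = k n (\<delta> (Suc n) v) \<oplus>\<^bsub>P (Suc n)\<^esub> \<delta> (Suc (Suc n)) (k (Suc n) v)"
    by (rule lifting_zero_null_homotopic) (rule that)
  show ?thesis
    by (rule that[OF k(1)]) (use k(2) bimod_homD(1)[OF k(1)] in blast)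
qed

lemma cocycle_H_sim_h:
  assumes \<phi>: "\<phi> \<in> cocycles P \<delta> (int (Suc m))"
  shows "(\<lambda>v. \<phi> (pull_homotopy m v) - \<phi> (h m v)) \<in> coboundaries P \<delta> (int m)"
proof -
  have \<phi>_hom: "\<phi> \<in> bimod_hom (P (Suc m)) regular_bimodule"
    using \<phi> by (simp add: cocycles_def cochains_nat del: of_nat_Suc)
  have \<phi>_\<delta>: "\<phi> (\<delta> (Suc (Suc m)) w) = 0" if "w \<in> carrier (P (Suc (Suc m)))" for w
    using \<phi> that by (auto simp: cocycles_def cx_obj_def cx_diff_def nat_add_distrib)
  obtain k where k: "\<And>n. k n \<in> bimod_hom (P n) (P (Suc n))"
    "\<And>n v. v \<in> carrier (P (Suc n)) \<Longrightarrow> \<exists>w\<in>carrier (P (Suc (Suc n))).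
      round_trip (Suc n) v \<ominus>\<^bsub>P (Suc n)\<^esub> v = k n (\<delta> (Suc n) v) \<oplus>\<^bsub>P (Suc n)\<^esub> \<delta> (Suc (Suc n)) w"
    by (rule round_trip_homotopy) (rule that)
  have \<phi>k: "(\<lambda>v. \<phi> (k m v)) \<in> bimod_hom (P m) regular_bimodule"
    by (rule bimod_hom_comp[OF \<phi>_hom k(1)])
  have \<phi>_round_trip: "\<phi> (round_trip (Suc m) v) = \<phi> v + \<phi> (k m (\<delta> (Suc m) v))"
    if v: "v \<in> carrier (P (Suc m))" for v
  proof -
    from k(2)[OF v] obtain w where w: "w \<in> carrier (P (Suc (Suc m)))"
      "round_trip (Suc m) v \<ominus>\<^bsub>P (Suc m)\<^esub> v = k m (\<delta> (Suc m) v) \<oplus>\<^bsub>P (Suc m)\<^esub> \<delta> (Suc (Suc m)) w"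
      by blast
    have "\<phi> (round_trip (Suc m) v) - \<phi> v = \<phi> (k m (\<delta> (Suc m) v) \<oplus>\<^bsub>P (Suc m)\<^esub> \<delta> (Suc (Suc m)) w)"
      using w(2) v by (simp add: round_trip_closed flip: hom_A_minus[OF \<phi>_hom])
    also have "\<dots> = \<phi> (k m (\<delta> (Suc m) v))"
      using v w(1) by (simp add: bimod_homD(2)[OF \<phi>_hom] bimod_homD(1)[OF k(1)] \<delta>_closed \<phi>_\<delta>)
    finally show ?thesis
      by (simp add: algebra_simps)
  qed
  \<comment> \<open>The defect absorbs the passage from \<open>h\<close> to p j h, and
    \<open>\<phi>_round_trip\<close> at \<open>h m v\<close> the one from p j to the
    identity.\<close>
  have eq: "\<phi> (pull_homotopy m v) - \<phi> (h m v) = \<phi> (defect m v) + \<phi> (k m (\<delta> (Suc m) (h m v)))"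
    if v: "v \<in> carrier (P m)" for v
    using v by (simp add: defect_def hom_A_minus[OF \<phi>_hom] pull_homotopy_closed
        round_trip_closed h_closed \<phi>_round_trip)
  have "\<exists>g\<in>cochains P (int m - 1). \<forall>v\<in>carrier (P m).
      \<phi> (pull_homotopy m v) - \<phi> (h m v) = g (cx_diff P \<delta> (int m) v)"
  proof (cases m)
    case 0
    \<comment> \<open>Degree 0 has only the zero coboundary. The defect lies in the kernel of
      \<open>\<delta> 1\<close>, which is the image of \<open>\<delta> 2\<close>, and \<phi> kills
      the latter.\<close>
    have "\<phi> (defect 0 v) = 0" if v: "v \<in> carrier (P 0)" for v
    proof -
      have "defect 0 v \<in> \<delta> 2 ` carrier (P 2)"
        using ker_\<delta>[of 0] defect_0[OF v] bimod_homD(1)[OF defect_hom v] by (simp add: numeral_2_eq_2)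
      then show ?thesis
        using \<phi>_\<delta> 0 by (auto simp: numeral_2_eq_2)
    qed
    then have "\<phi> (pull_homotopy m v) - \<phi> (h m v) = 0" if "v \<in> carrier (P m)" for v
      using eq[OF that] that 0 hom_A_eta[OF \<phi>k] by (simp add: h_0[simplified])
    moreover have "(\<lambda>v. 0) \<in> cochains P (int m - 1)"
      by (auto simp: cochains_def intro!: bimod_homI)
    ultimately show ?thesis
      by (intro bexI[of _ "\<lambda>v. 0"]) auto
  next
    case (Suc q)
    obtain u where u: "\<And>n. u n \<in> bimod_hom (P n) (P (Suc (Suc n)))"
      "\<And>n v. v \<in> carrier (P (Suc n)) \<Longrightarrow> \<exists>w\<in>carrier (P (Suc (Suc (Suc n)))).
        defect (Suc n) v = u n (\<delta> (Suc n) v) \<oplus>\<^bsub>P (Suc (Suc n))\<^esub> \<delta> (Suc (Suc (Suc n))) w"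
      by (rule anti_chain_map_null_homotopic[OF defect_hom defect_0 defect_Suc])
        (assumption+, (rule that; assumption))
    \<comment> \<open>The first summand is a primitive of \<phi> on the defect. The second comes
      from \<phi> k \<delta> h = \<phi> k (\<eta> - h \<delta>) = - \<phi> k h \<delta>.\<close>
    let ?g = "\<lambda>w. \<phi> (u q w) - \<phi> (k m (h q w))"
    have "\<phi> \<circ> u q \<in> cochains P (int q)" "(\<lambda>v. \<phi> (k m v)) \<circ> h q \<in> cochains P (int q)"
      using bimod_hom_comp[OF \<phi>_hom u(1)[of q, folded Suc]] bimod_hom_comp[OF \<phi>k h_hom[of q, folded Suc]]
      by (simp_all add: cochains_nat comp_def)
    from cochains_diff[OF this] have g_in: "?g \<in> cochains P (int m - 1)"
      by (simp add: Suc comp_def)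
    have g_eq: "\<phi> (pull_homotopy m v) - \<phi> (h m v) = ?g (cx_diff P \<delta> (int m) v)"
      if v: "v \<in> carrier (P m)" for v
    proof -
      from u(2)[of v q] v Suc obtain w where w: "w \<in> carrier (P (Suc (Suc m)))"
        "defect m v = u q (\<delta> m v) \<oplus>\<^bsub>P (Suc m)\<^esub> \<delta> (Suc (Suc m)) w"
        by auto
      have u_cl: "u q (\<delta> m v) \<in> carrier (P (Suc m))"
        using bimod_homD(1)[OF u(1)[of q]] \<delta>_closed v Suc by simp
      have h_cl: "h q (\<delta> m v) \<in> carrier (P m)"
        using h_closed[of _ q] \<delta>_closed v Suc by simp
      have "\<phi> (defect m v) = \<phi> (u q (\<delta> m v))"
        using w u_cl by (simp add: bimod_homD(2)[OF \<phi>_hom] \<phi>_\<delta> \<delta>_closed)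
      moreover have "\<phi> (k m (\<delta> (Suc m) (h m v))) = - \<phi> (k m (h q (\<delta> m v)))"
        using v h_cl hom_A_eta[OF \<phi>k v] h_Suc[of v q] hom_A_minus[OF \<phi>k eta_closed[OF v] h_cl] Suc by simp
      ultimately show ?thesis
        using eq[OF v] Suc by (simp add: cx_diff_def nat_add_distrib)
    qed
    show ?thesis
      by (intro bexI[OF _ g_in] ballI g_eq)
  qed
  moreover have "(\<lambda>v. \<phi> (pull_homotopy m v) - \<phi> (h m v)) \<in> cochains P (int m)"
    using bimod_hom_comp[OF \<phi>_hom pull_homotopy_hom] bimod_hom_comp[OF \<phi>_hom h_hom]
    by (intro cochains_diff) (simp_all add: cochains_nat)
  ultimately show ?thesis
    by (simp add: coboundaries_def cx_obj_def)
qed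

text \<open>By the homotopy equation \<phi> h \<delta> = \<phi> \<eta> - \<phi> \<delta> h. The
  first term vanishes because \<phi> takes values in the algebra, the second because \<phi> is a
  cocycle.\<close>

lemma cocycle_h_pred:
  assumes \<phi>: "\<phi> \<in> cocycles P \<delta> (int n)"
  shows "\<phi> \<circ> h_pred P h n \<in> cocycles P \<delta> (int n - 1)"
proof -
  have \<phi>_hom: "\<phi> \<in> bimod_hom (P n) regular_bimodule"
    using \<phi> by (simp add: cocycles_def cochains_nat)
  have \<phi>_\<delta>: "\<phi> (\<delta> (Suc n) w) = 0" if "w \<in> carrier (P (Suc n))" for w
    using \<phi> that by (auto simp: cocycles_def cx_obj_def cx_diff_def nat_add_distrib)
  show ?thesis
  proof (cases n)
    case 0
    then have "\<phi> \<circ> h_pred P h n = (\<lambda>v. 0)"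
      using hom_A_zero[OF \<phi>_hom] by (simp add: h_pred_def comp_def)
    moreover have "(\<lambda>v. 0) \<in> cochains P (int n - 1)"
      by (auto simp: cochains_def intro!: bimod_homI)
    ultimately show ?thesis
      by (simp add: cocycles_def)
  next
    case (Suc m)
    have "\<phi> (h m (\<delta> n v)) = 0" if v: "v \<in> carrier (P n)" for v
    proof -
      have h_cl: "h m (\<delta> n v) \<in> carrier (P n)"
        using h_closed \<delta>_closed v Suc by simp
      have "\<phi> (\<delta> (Suc n) (h n v)) = \<phi> (eta P \<rho> n v) - \<phi> (h m (\<delta> n v))"
        using h_Suc[of v m] v Suc hom_A_minus[OF \<phi>_hom eta_closed[OF v] h_cl] by simp
      then show ?thesis
        by (simp add: \<phi>_\<delta> h_closed v hom_A_eta[OF \<phi>_hom])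
    qed
    moreover have "\<phi> \<circ> h m \<in> bimod_hom (P m) regular_bimodule"
      using bimod_hom_comp[OF \<phi>_hom h_hom[of m, folded Suc]] by (simp add: comp_def)
    ultimately show ?thesis
      using Suc by (simp add: cocycles_def cochains_nat h_pred_def cx_obj_def cx_diff_def nat_add_distrib)
  qed
qed

lemma bracket_sim_h:
  assumes \<phi>: "\<phi> \<in> cocycles P \<delta> (int n)"
    and g: "g \<in> bimod_hom (bar s 0) regular_bimodule" "g (pure_tensor s [1, 1]) = \<rho>"
  shows "(\<lambda>v. bar_bracket s n (\<phi> \<circ> p n) 0 g (j (n - 1) v) - \<phi> (h_pred P h n v))
    \<in> coboundaries P \<delta> (int n - 1)" (is "?F \<in> _")
proof (cases n)
  case 0
  have \<phi>_hom: "\<phi> \<in> bimod_hom (P 0) regular_bimodule"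
    using \<phi> 0 cochains_nat[of P 0] by (simp add: cocycles_def)
  \<comment> \<open>In degree -1 the carrier is the zero of \<open>P 0\<close> alone, so this one
    value decides everything; the truncated index \<open>n - 1\<close> selects
    \<open>j 0\<close>.\<close>
  have "?F \<zero>\<^bsub>P 0\<^esub> = 0"
    using bar_bracket_zero_zero[OF j_closed] 0 hom_A_zero[OF \<phi>_hom] by (simp add: h_pred_def)
  then have "?F \<in> cochains P (int n - 1)"
    using 0 by (auto simp: cochains_def cx_obj_def intro!: bimod_homI)
  moreover have "(\<lambda>v. 0) \<in> cochains P (int n - 1 - 1)"
    by (auto simp: cochains_def intro!: bimod_homI)
  ultimately show ?thesis
    using \<open>?F \<zero>\<^bsub>P 0\<^esub> = 0\<close> 0 by (auto simp: coboundaries_def cx_obj_def)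
next
  case (Suc m)
  have \<phi>_hom: "\<phi> \<in> bimod_hom (P (Suc m)) regular_bimodule"
    using \<phi> Suc by (simp add: cocycles_def cochains_nat del: of_nat_Suc)
  have "\<phi> \<circ> p n \<in> bimod_hom (bar s (Suc m)) regular_bimodule"
    using bimod_hom_comp[OF \<phi>_hom p_hom] Suc by (simp add: comp_def)
  then have F: "?F v = \<phi> (pull_homotopy m v) - \<phi> (h m v)" if "v \<in> carrier (P m)" for v
    using bar_bracket_degree_zero[OF _ g j_closed[OF that]] Suc by (simp add: pull_homotopy_def h_pred_def)
  \<comment> \<open>\<open>F\<close> holds on the carrier of \<open>P m\<close>, so membership is
    carried over by \<open>bimod_hom_cong\<close>; the coboundary equation is itself tested on the
    carrier.\<close>
  then have "?F \<in> coboundaries P \<delta> (int m)"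
    using cocycle_H_sim_h[OF \<phi>[unfolded Suc]] P.bimod_hom_cong[of _ m regular_bimodule ?F]
    by (auto simp: coboundaries_def cochains_nat cx_obj_def)
  then show ?thesis
    by (simp add: Suc)
qed

end

theorem theorem2p6:
  fixes s :: "'k::field \<Rightarrow> 'a::{ring,monoid_mult} \<Rightarrow> 'a"
    and P :: "nat \<Rightarrow> ('a, 'p) bimodule"
    and \<delta> :: "nat \<Rightarrow> 'p \<Rightarrow> 'p"
    and \<mu> :: "'p \<Rightarrow> 'a"
    and i :: "nat \<Rightarrow> 'p \<Rightarrow> ('a, 'k) tensor"
    and \<rho> :: 'a
    and l :: "('a, 'k) tensor \<Rightarrow> 'a"
  assumes "assoc_algebra s"
    and "projective_resolution s P \<delta> \<mu>"
    and "is_lifting P \<delta> \<mu> (bar s) (bar_diff s) (bar_aug s) (\<lambda>a. a) i"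
    and "\<forall>a. \<rho> * a = a * \<rho>"
    and "l \<in> bimod_hom (bar s 0) regular_bimodule"
    and "l (pure_tensor s [1, 1]) = \<rho>"
  shows "is_lifting P \<delta> \<mu> P \<delta> \<mu> (\<lambda>a. 0) (eta P \<rho>) \<and>
    (\<exists>h. is_eta_homotopy P \<delta> \<rho> h) \<and>
    (\<forall>h n \<phi> i' p.
      is_eta_homotopy P \<delta> \<rho> h \<longrightarrow>
      \<phi> \<in> cocycles P \<delta> (int n) \<longrightarrow>
      is_lifting P \<delta> \<mu> (bar s) (bar_diff s) (bar_aug s) (\<lambda>a. a) i' \<longrightarrow>
      is_lifting (bar s) (bar_diff s) (bar_aug s) P \<delta> \<mu> (\<lambda>a. a) p \<longrightarrow>
      HH_bracket s P \<delta> i' p n \<phi> 0 (l \<circ> i 0) \<in> HH P \<delta> (int n - 1) \<and>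
      HH_bracket s P \<delta> i' p n \<phi> 0 (l \<circ> i 0) = coh_class P \<delta> (int n - 1) (\<phi> \<circ> h_pred P h n))"
proof (intro conjI allI impI)
  interpret central_bimodule_resolution s P \<delta> \<mu> \<rho>
    using assms(1,2,4) by (simp add: central_bimodule_resolution_def central_bimodule_resolution_axioms_def
        bimodule_resolution_def bimodule_resolution_axioms_def)
  show "is_lifting P \<delta> \<mu> P \<delta> \<mu> (\<lambda>a. 0) (eta P \<rho>)"
    by (rule eta_lifting)
  show "\<exists>h. is_eta_homotopy P \<delta> \<rho> h"
    by (rule eta_homotopy_exists)
  fix h n \<phi> i' p
  assume h: "is_eta_homotopy P \<delta> \<rho> h" and \<phi>: "\<phi> \<in> cocycles P \<delta> (int n)"
    and i': "is_lifting P \<delta> \<mu> (bar s) (bar_diff s) (bar_aug s) (\<lambda>a. a) i'"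
    and p: "is_lifting (bar s) (bar_diff s) (bar_aug s) P \<delta> \<mu> (\<lambda>a. a) p"
  interpret central_comparison s P \<delta> \<mu> \<rho> h i' p
    by unfold_locales (fact h i' p)+
  have i0: "i 0 \<in> bimod_hom (P 0) (bar s 0)" "\<And>v. v \<in> carrier (P 0) \<Longrightarrow> bar_aug s (i 0 v) = \<mu> v"
    using assms(3) by (simp_all add: is_lifting_def)
  let ?g = "(l \<circ> i 0) \<circ> p 0"
  have g: "?g \<in> bimod_hom (bar s 0) regular_bimodule"
    using bimod_hom_comp[OF assms(5) bimod_hom_comp[OF i0(1) p_hom]] by (simp add: comp_def)
  have one: "pure_tensor s [1, 1] \<in> carrier (bar s 0)"
    by (auto simp: carrier_bar pure_tensor_def intro!: imageI)
  \<comment> \<open>The element i_0 p_0 (1|1) may differ from 1|1, but both comparison maps respect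
    augmentations, so its augmentation is still 1, and by \<open>hom_bar_0_eq\<close> this
    determines the value of \<open>l\<close>.\<close>
  have "l (i 0 (p 0 (pure_tensor s [1, 1]))) = \<rho> * bar_aug s (i 0 (p 0 (pure_tensor s [1, 1])))"
    by (rule hom_bar_0_eq[OF assms(5,6) central bimod_homD(1)[OF i0(1) p_closed[OF one]]])
  also have "\<dots> = \<rho>"
    using one by (simp add: i0(2) p_closed p_aug bar_aug_one)
  finally have g1: "?g (pure_tensor s [1, 1]) = \<rho>"
    by simp
  show eq: "HH_bracket s P \<delta> i' p n \<phi> 0 (l \<circ> i 0) = coh_class P \<delta> (int n - 1) (\<phi> \<circ> h_pred P h n)"
    unfolding HH_bracket_def
    using coh_class_eqI[OF bracket_sim_h[OF \<phi> g g1]] by (simp add: comp_def)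
  \<comment> \<open>The cocycle condition is read off the representative \<phi> h, for which it is
    immediate from the homotopy equation.\<close>
  show "HH_bracket s P \<delta> i' p n \<phi> 0 (l \<circ> i 0) \<in> HH P \<delta> (int n - 1)"
    unfolding eq HH_def by (rule imageI[OF cocycle_h_pred[OF \<phi>]])
qed

end
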